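(* Let $V$ be a finite-dimensional Euclidean Jordan algebra (over $\mathbb{R}$, with identity $e$) of rank $d$, with cone of squares $\mathcal{Q}$. Let $\mathcal{K}_{\mathrm{rtdet}} = \{ (u, w) \in \mathbb{R} \times \mathcal{Q} : u \leq \det(w)^{1/d} \}$ and let $\Gamma : \operatorname{int}(\mathcal{K}_{\mathrm{rtdet}}) \to \mathbb{R}$ be $\Gamma(u,w) = -\log( \det(w)^{1/d} - u ) - \log(\det(w))$. Let $\tilde u = (u,w) \in \operatorname{int}(\mathcal{K}_{\mathrm{rtdet}})$ and $\tilde p = (p, r) \in \mathbb{R} \times V$. Put $$\varphi = \det(w)^{1/d}, \quad \zeta = \varphi - u, \quad \eta = d^{-1} \varphi \zeta^{-1}, \quad \theta = 1 + \eta, \quad \check r = P(w^{1/2}) r .$$ Then the inverse Hessian product $(\bar H_u, \bar H_w) = (\nabla^2 \Gamma(\tilde u))^{-1}[\tilde p] \in \mathbb{R} \times V$ is $$\bar H_u = (\zeta^2 + d^{-1} \varphi^2)\, p + d^{-1} \varphi \operatorname{tr}(\check r),$$ $$\bar H_w = P(w^{1/2}) \Bigl( d^{-1} \bigl( \varphi p + \eta \theta^{-1} \operatorname{tr}(\check r) \bigr) e + \theta^{-1} \check r \Bigr).$$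
   Context: $\operatorname{int}$ denotes interior. Jordan algebra conventions: the product is $\circ$; a Jordan algebra is Euclidean if $\langle w_a \circ w_b, w_c\rangle = \langle w_b, w_a \circ w_c\rangle$ for an inner product. The rank $d$ of $V$ is the number of elements in any Jordan frame (complete system of pairwise orthogonal primitive idempotents, summing to $e$). Every $w \in V$ has a spectral decomposition $w = \sum_{i=1}^d w_i c_i$ with real eigenvalues $w_i$ and a Jordan frame $c_1,\dots,c_d$. One sets $\operatorname{tr}(w) = \sum_i w_i$ and $\det(w) = \prod_i w_i$. The inner product on $V$ is $\langle w_a, w_b \rangle = \operatorname{tr}(w_a \circ w_b)$, and $\mathbb{R}\times V$ carries the product inner product. The cone of squares is $\mathcal{Q} = \{ w \circ w : w \in V\}$; $w \in \operatorname{int}(\mathcal{Q})$ iff all $w_i > 0$, and then $w^{1/2} = \sum_i w_i^{1/2} c_i$. $L(w) : V \to V$ is $L(w) x = w \circ x$, and the quadratic representation is $P(w) = 2 L(w)^2 - L(w \circ w)$. The Hessian $\nabla^2 \Gamma(\tilde u)$ is viewed as the self-adjoint linear operator on $\mathbb{R} \times V$ with $\langle \nabla^2\Gamma(\tilde u)[\tilde p], \tilde p'\rangle$ equal to the second directional derivative of $\Gamma$ at $\tilde u$ in directions $\tilde p, \tilde p'$; it is positive definite, and $(\nabla^2 \Gamma(\tilde u))^{-1}$ is its inverse operator. *)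

theory Defs
  imports "HOL-Analysis.Analysis"
begin

text \<open>
  The inner product of the class \<^class>\<open>euclidean_space\<close> plays the role of the (arbitrary)
  associative inner product that makes the Jordan algebra Euclidean; it also supplies the topology.
  It need not be the canonical inner product tr (x o y), which is \<open>jinner\<close> below.
\<close>

class euclidean_jordan_algebra = euclidean_space +
  fixes jprod :: "'a \<Rightarrow> 'a \<Rightarrow> 'a"  (infixl "\<circ>\<^sub>J" 70)
    and jone :: 'a
  assumes jprod_add_left: "(x + y) \<circ>\<^sub>J z = x \<circ>\<^sub>J z + y \<circ>\<^sub>J z"
    and jprod_scaleR_left: "(a *\<^sub>R x) \<circ>\<^sub>J y = a *\<^sub>R (x \<circ>\<^sub>J y)"
    and jprod_commute: "x \<circ>\<^sub>J y = y \<circ>\<^sub>J x"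
    and jordan_identity: "x \<circ>\<^sub>J ((x \<circ>\<^sub>J x) \<circ>\<^sub>J y) = (x \<circ>\<^sub>J x) \<circ>\<^sub>J (x \<circ>\<^sub>J y)"
    and jone_left: "jone \<circ>\<^sub>J x = x"
    and inner_jprod_assoc: "inner (x \<circ>\<^sub>J y) z = inner y (x \<circ>\<^sub>J z)"

definition jL :: "'a::euclidean_jordan_algebra \<Rightarrow> 'a \<Rightarrow> 'a" where
  "jL w = (\<lambda>x. w \<circ>\<^sub>J x)"

definition quad_rep :: "'a::euclidean_jordan_algebra \<Rightarrow> 'a \<Rightarrow> 'a" where
  "quad_rep w = (\<lambda>x. 2 *\<^sub>R jL w (jL w x) - jL (w \<circ>\<^sub>J w) x)"

definition idempotent :: "'a::euclidean_jordan_algebra \<Rightarrow> bool" where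
  "idempotent c \<longleftrightarrow> c \<circ>\<^sub>J c = c"

definition primitive_idempotent :: "'a::euclidean_jordan_algebra \<Rightarrow> bool" where
  "primitive_idempotent c \<longleftrightarrow> idempotent c \<and> c \<noteq> 0 \<and>
     \<not> (\<exists>a b. idempotent a \<and> idempotent b \<and> a \<noteq> 0 \<and> b \<noteq> 0 \<and> c = a + b)"

text \<open>Nothing is lost by taking frames to be sets rather than families: orthogonal nonzero
  idempotents are distinct. Eigenvalues are accordingly indexed by the members of the frame.\<close>

definition jordan_frame :: "'a::euclidean_jordan_algebra set \<Rightarrow> bool" where
  "jordan_frame C \<longleftrightarrow> finite C \<and> (\<forall>c\<in>C. primitive_idempotent c) \<and>
     (\<forall>a\<in>C. \<forall>b\<in>C. a \<noteq> b \<longrightarrow> a \<circ>\<^sub>J b = 0) \<and> (\<Sum>c\<in>C. c) = jone"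

definition jrank :: "'a::euclidean_jordan_algebra itself \<Rightarrow> nat" where
  "jrank _ = (THE d. \<exists>C::'a set. jordan_frame C \<and> card C = d)"

definition spectral_decomp ::
  "'a::euclidean_jordan_algebra \<Rightarrow> 'a set \<Rightarrow> ('a \<Rightarrow> real) \<Rightarrow> bool" where
  "spectral_decomp w C ev \<longleftrightarrow> jordan_frame C \<and> w = (\<Sum>c\<in>C. ev c *\<^sub>R c)"

definition jtr :: "'a::euclidean_jordan_algebra \<Rightarrow> real" where
  "jtr w = (THE t. \<exists>C ev. spectral_decomp w C ev \<and> t = (\<Sum>c\<in>C. ev c))"

definition jdet :: "'a::euclidean_jordan_algebra \<Rightarrow> real" where
  "jdet w = (THE t. \<exists>C ev. spectral_decomp w C ev \<and> t = (\<Prod>c\<in>C. ev c))"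

text \<open>Only meaningful on the cone of squares, where all eigenvalues are nonnegative.\<close>

definition jsqrt :: "'a::euclidean_jordan_algebra \<Rightarrow> 'a" where
  "jsqrt w = (THE s. \<exists>C ev. spectral_decomp w C ev \<and> s = (\<Sum>c\<in>C. sqrt (ev c) *\<^sub>R c))"

definition cone_squares :: "'a::euclidean_jordan_algebra set" where
  "cone_squares = {w \<circ>\<^sub>J w | w. True}"

definition jinner :: "'a::euclidean_jordan_algebra \<Rightarrow> 'a \<Rightarrow> real" where
  "jinner x y = jtr (x \<circ>\<^sub>J y)"

definition prod_jinner ::
  "real \<times> 'a::euclidean_jordan_algebra \<Rightarrow> real \<times> 'a \<Rightarrow> real" where
  "prod_jinner x y = fst x * fst y + jinner (snd x) (snd y)"

text \<open>A relation rather than a value, so that existence of the derivatives is part of the claim;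
  the first derivative is needed in a whole neighbourhood of \<open>x\<close>.\<close>

definition has_second_dir_deriv ::
  "('b::real_normed_vector \<Rightarrow> real) \<Rightarrow> 'b \<Rightarrow> 'b \<Rightarrow> 'b \<Rightarrow> real \<Rightarrow> bool" where
  "has_second_dir_deriv f x p q D \<longleftrightarrow>
     (\<exists>g. (\<forall>\<^sub>F y in nhds x. ((\<lambda>t. f (y + t *\<^sub>R p)) has_real_derivative g y) (at 0)) \<and>
          ((\<lambda>t. g (x + t *\<^sub>R q)) has_real_derivative D) (at 0))"

definition is_hessian ::
  "(real \<times> 'a::euclidean_jordan_algebra \<Rightarrow> real) \<Rightarrow> real \<times> 'a \<Rightarrow>
   (real \<times> 'a \<Rightarrow> real \<times> 'a) \<Rightarrow> bool" where
  "is_hessian f x H \<longleftrightarrow> linear H \<and>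
     (\<forall>p q. prod_jinner (H p) q = prod_jinner p (H q)) \<and>
     (\<forall>p q. has_second_dir_deriv f x p q (prod_jinner (H p) q))"

definition hessian ::
  "(real \<times> 'a::euclidean_jordan_algebra \<Rightarrow> real) \<Rightarrow> real \<times> 'a \<Rightarrow> real \<times> 'a \<Rightarrow> real \<times> 'a" where
  "hessian f x = (THE H. is_hessian f x H)"

definition rtdet :: "'a::euclidean_jordan_algebra \<Rightarrow> real" where
  "rtdet w = jdet w powr (1 / real (jrank TYPE('a)))"

definition K_rtdet :: "(real \<times> 'a::euclidean_jordan_algebra) set" where
  "K_rtdet = {(u, w). w \<in> cone_squares \<and> u \<le> rtdet w}"

text \<open>Only the values on the interior of \<^const>\<open>K_rtdet\<close> matter.\<close>

definition Gamma_rtdet :: "real \<times> 'a::euclidean_jordan_algebra \<Rightarrow> real" where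
  "Gamma_rtdet = (\<lambda>(u, w). - ln (rtdet w - u) - ln (jdet w))"

end

theory Submission
  imports Defs
begin

text \<open>
  Write \<open>L(w)\<close> for multiplication by \<open>w\<close> and \<open>P(w)\<close> for the quadratic representation.
  For \<open>w\<close> in the interior of the cone of squares, \<open>ln det\<close> has gradient \<open>w\<^sup>-\<^sup>1\<close> for the trace
  form, and the derivative of \<open>w\<^sup>-\<^sup>1\<close> in direction \<open>q\<close> is \<open>- P(w\<^sup>-\<^sup>1) q\<close>.  The chain rule
  then expresses the Hessian of the barrier as a combination of \<open>P(w\<^sup>-\<^sup>1)\<close> and rank-one terms
  built from \<open>w\<^sup>-\<^sup>1\<close>.  As \<open>P(w)\<close> inverts \<open>P(w\<^sup>-\<^sup>1)\<close> and maps \<open>w\<^sup>-\<^sup>1\<close> to \<open>w\<close>, the inverse has to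
  have the form \<open>k w + P(w) r / \<theta>\<close> in its second component, and comparing coefficients gives
  the stated formula (\<open>Gamma_hessian_inverse\<close>).

  Three facts about Euclidean Jordan algebras carry this.

  Spectral decompositions exist (\<open>spectral_decomp_exists\<close>).  The powers of an element span an
  associative algebra of commuting self-adjoint operators.  A minimal ideal of such an algebra is
  the line through an idempotent, so the algebra is spanned by orthogonal idempotents, and these
  can be split until they are primitive.

  The trace is linear and associative (\<open>jtr_eq_inner\<close>, \<open>jtr_assoc\<close>).  Two primitive idempotents
  that are not orthogonal have the same norm.  Hence the vector with coefficients \<open>1 / |c|\<^sup>2\<close> in
  a frame pairs to 1 with every primitive idempotent of the algebra, whatever the frame.  Pairing
  with it is the trace; in particular the rank and the trace are well defined.

  The determinant can be differentiated through a convexity argument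
  (\<open>ln_jdet_gradient_inequality\<close>, \<open>ln_jdet_has_derivative\<close>).  The numbers \<open>tr (c \<circ> d)\<close> for \<open>c\<close> and \<open>d\<close>
  in two frames form a doubly stochastic matrix, and averaging \<open>ln s \<le> s - 1\<close> with these weights
  yields \<open>ln det y - ln det x \<le> tr (x\<^sup>-\<^sup>1 \<circ> (y - x))\<close>.  Applied in both directions along a
  line, it squeezes the difference quotient.
\<close>

section \<open>The linearised Jordan identity\<close>

lemma jprod_add_right: "x \<circ>\<^sub>J (y + z) = x \<circ>\<^sub>J y + x \<circ>\<^sub>J (z :: 'a::euclidean_jordan_algebra)"
  by (metis jprod_add_left jprod_commute)

lemma jprod_scaleR_right: "x \<circ>\<^sub>J (a *\<^sub>R y) = a *\<^sub>R (x \<circ>\<^sub>J (y :: 'a::euclidean_jordan_algebra))"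
  by (metis jprod_scaleR_left jprod_commute)

interpretation jprod: bounded_bilinear "(\<circ>\<^sub>J) :: 'a::euclidean_jordan_algebra \<Rightarrow> 'a \<Rightarrow> 'a"
  unfolding bilinear_conv_bounded_bilinear[symmetric] bilinear_def
  by (auto intro!: linearI simp: jprod_add_left jprod_add_right jprod_scaleR_left jprod_scaleR_right)

lemmas jprod_linear_simps =
  jprod.add_left jprod.add_right jprod.diff_left jprod.diff_right
  jprod.minus_left jprod.minus_right jprod.scaleR_left jprod.scaleR_right

lemma jone_right: "x \<circ>\<^sub>J jone = (x :: 'a::euclidean_jordan_algebra)"
  by (metis jprod_commute jone_left)

lemma inner_jprod_assoc_right: "inner x (y \<circ>\<^sub>J z) = inner (y \<circ>\<^sub>J x) (z :: 'a::euclidean_jordan_algebra)"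
  by (simp add: inner_jprod_assoc)

lemma vector_eq_from_inner:
  fixes a b :: "'a::real_inner"
  assumes "\<And>k. inner a k = inner b k"
  shows "a = b"
  using assms vector_eq_rdot by blast

lemma jordan_identity_polarized:
  fixes x y z :: "'a::euclidean_jordan_algebra"
  shows "z \<circ>\<^sub>J ((x \<circ>\<^sub>J x) \<circ>\<^sub>J y) + 2 *\<^sub>R (x \<circ>\<^sub>J ((x \<circ>\<^sub>J z) \<circ>\<^sub>J y))
       = 2 *\<^sub>R ((x \<circ>\<^sub>J z) \<circ>\<^sub>J (x \<circ>\<^sub>J y)) + (x \<circ>\<^sub>J x) \<circ>\<^sub>J (z \<circ>\<^sub>J y)"
proof (rule vector_eq_from_inner)
  fix k
  have a: "inner ((x+z) \<circ>\<^sub>J (((x+z) \<circ>\<^sub>J (x+z)) \<circ>\<^sub>J y)) k = inner (((x+z) \<circ>\<^sub>J (x+z)) \<circ>\<^sub>J ((x+z) \<circ>\<^sub>J y)) k"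
    and b: "inner ((x-z) \<circ>\<^sub>J (((x-z) \<circ>\<^sub>J (x-z)) \<circ>\<^sub>J y)) k = inner (((x-z) \<circ>\<^sub>J (x-z)) \<circ>\<^sub>J ((x-z) \<circ>\<^sub>J y)) k"
    and c: "inner (z \<circ>\<^sub>J ((z \<circ>\<^sub>J z) \<circ>\<^sub>J y)) k = inner ((z \<circ>\<^sub>J z) \<circ>\<^sub>J (z \<circ>\<^sub>J y)) k"
    by (simp_all only: jordan_identity)
  have zx: "z \<circ>\<^sub>J x = x \<circ>\<^sub>J z" by (rule jprod_commute)
  show "inner (z \<circ>\<^sub>J ((x \<circ>\<^sub>J x) \<circ>\<^sub>J y) + 2 *\<^sub>R (x \<circ>\<^sub>J ((x \<circ>\<^sub>J z) \<circ>\<^sub>J y))) k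
       = inner (2 *\<^sub>R ((x \<circ>\<^sub>J z) \<circ>\<^sub>J (x \<circ>\<^sub>J y)) + (x \<circ>\<^sub>J x) \<circ>\<^sub>J (z \<circ>\<^sub>J y)) k"
    using a b c by (simp add: jprod_linear_simps inner_add_left inner_diff_left zx)
qed

lemma jordan_identity_linearized:
  fixes x y z w :: "'a::euclidean_jordan_algebra"
  shows "z \<circ>\<^sub>J ((x \<circ>\<^sub>J w) \<circ>\<^sub>J y) + w \<circ>\<^sub>J ((x \<circ>\<^sub>J z) \<circ>\<^sub>J y) + x \<circ>\<^sub>J ((w \<circ>\<^sub>J z) \<circ>\<^sub>J y)
       = (w \<circ>\<^sub>J z) \<circ>\<^sub>J (x \<circ>\<^sub>J y) + (x \<circ>\<^sub>J z) \<circ>\<^sub>J (w \<circ>\<^sub>J y) + (x \<circ>\<^sub>J w) \<circ>\<^sub>J (z \<circ>\<^sub>J y)"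
proof (rule vector_eq_from_inner)
  fix k
  note jp = arg_cong[where f="\<lambda>v. inner v k", OF jordan_identity_polarized]
  have wx: "w \<circ>\<^sub>J x = x \<circ>\<^sub>J w" by (rule jprod_commute)
  show "inner (z \<circ>\<^sub>J ((x \<circ>\<^sub>J w) \<circ>\<^sub>J y) + w \<circ>\<^sub>J ((x \<circ>\<^sub>J z) \<circ>\<^sub>J y) + x \<circ>\<^sub>J ((w \<circ>\<^sub>J z) \<circ>\<^sub>J y)) k
       = inner ((w \<circ>\<^sub>J z) \<circ>\<^sub>J (x \<circ>\<^sub>J y) + (x \<circ>\<^sub>J z) \<circ>\<^sub>J (w \<circ>\<^sub>J y) + (x \<circ>\<^sub>J w) \<circ>\<^sub>J (z \<circ>\<^sub>J y)) k"
    using jp[of z "x+w" y] jp[of z x y] jp[of z w y]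
    by (simp add: jprod_linear_simps inner_add_left inner_diff_left wx)
qed

text \<open>
  The identity above, read as an equation between linear operators acting on \<open>w\<close>: it expresses
  multiplication by a product of three elements through multiplications by products of two.
\<close>

lemma jprod_triple:
  fixes x y z w :: "'a::euclidean_jordan_algebra"
  shows "((x \<circ>\<^sub>J z) \<circ>\<^sub>J y) \<circ>\<^sub>J w
       = (x \<circ>\<^sub>J y) \<circ>\<^sub>J (z \<circ>\<^sub>J w) + (x \<circ>\<^sub>J z) \<circ>\<^sub>J (y \<circ>\<^sub>J w) + (z \<circ>\<^sub>J y) \<circ>\<^sub>J (x \<circ>\<^sub>J w)
         - z \<circ>\<^sub>J (y \<circ>\<^sub>J (x \<circ>\<^sub>J w)) - x \<circ>\<^sub>J (y \<circ>\<^sub>J (z \<circ>\<^sub>J w))"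
  using jordan_identity_linearized[of z x w y]
  by (simp add: jprod_commute algebra_simps)

section \<open>Powers\<close>

primrec jpow :: "'a::euclidean_jordan_algebra \<Rightarrow> nat \<Rightarrow> 'a" where
  "jpow x 0 = jone"
| "jpow x (Suc n) = x \<circ>\<^sub>J jpow x n"

lemma jpow_recursion:
  fixes x y :: "'a::euclidean_jordan_algebra"
  shows "jpow x (Suc (Suc n)) \<circ>\<^sub>J y
     = (x \<circ>\<^sub>J x) \<circ>\<^sub>J (jpow x n \<circ>\<^sub>J y) + 2 *\<^sub>R (jpow x (Suc n) \<circ>\<^sub>J (x \<circ>\<^sub>J y))
       - jpow x n \<circ>\<^sub>J (x \<circ>\<^sub>J (x \<circ>\<^sub>J y)) - x \<circ>\<^sub>J (x \<circ>\<^sub>J (jpow x n \<circ>\<^sub>J y))"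
  using jprod_triple[of x "jpow x n" x y]
  by (simp add: jprod_commute[of "jpow x n" x] jprod_commute[of "x \<circ>\<^sub>J jpow x n" x] scaleR_2)

text \<open>
  By the recursion, multiplication by any power is a polynomial in the two commuting operators
  of multiplication by \<open>x\<close> and by its square.
\<close>

lemma jpow_commute:
  fixes x y :: "'a::euclidean_jordan_algebra"
  shows "x \<circ>\<^sub>J (jpow x n \<circ>\<^sub>J y) = jpow x n \<circ>\<^sub>J (x \<circ>\<^sub>J y)"
proof -
  have "(\<forall>y. x \<circ>\<^sub>J (jpow x n \<circ>\<^sub>J y) = jpow x n \<circ>\<^sub>J (x \<circ>\<^sub>J y))
      \<and> (\<forall>y. x \<circ>\<^sub>J (jpow x (Suc n) \<circ>\<^sub>J y) = jpow x (Suc n) \<circ>\<^sub>J (x \<circ>\<^sub>J y))"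
  proof (induction n)
    case 0
    show ?case by (simp add: jone_left jone_right)
  next
    case (Suc n)
    then have a: "x \<circ>\<^sub>J (jpow x n \<circ>\<^sub>J y) = jpow x n \<circ>\<^sub>J (x \<circ>\<^sub>J y)"
      and b: "x \<circ>\<^sub>J (jpow x (Suc n) \<circ>\<^sub>J y) = jpow x (Suc n) \<circ>\<^sub>J (x \<circ>\<^sub>J y)" for y by blast+
    have "x \<circ>\<^sub>J (jpow x (Suc (Suc n)) \<circ>\<^sub>J y) = jpow x (Suc (Suc n)) \<circ>\<^sub>J (x \<circ>\<^sub>J y)" for y
      unfolding jpow_recursion
      by (simp only: jprod_linear_simps jordan_identity a b)
    with b show ?case by blast
  qed
  then show ?thesis by blast
qed

lemma jpow_add: "jpow x m \<circ>\<^sub>J jpow x n = jpow (x::'a::euclidean_jordan_algebra) (m + n)"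
  by (induction n) (simp_all add: jone_right jpow_commute[symmetric])

text \<open>
  The recursion turns multiplication by \<open>s\<^sup>4\<close> into a polynomial in the commuting operators of
  multiplication by \<open>s\<close> and by \<open>s\<^sup>2\<close>, so \<open>P(s)\<^sup>2 = P(s\<^sup>2)\<close> becomes an identity between polynomials.
\<close>

lemma quad_rep_square:
  fixes s v :: "'a::euclidean_jordan_algebra"
  shows "quad_rep s (quad_rep s v) = quad_rep (s \<circ>\<^sub>J s) v"
proof -
  have p2: "jpow s (Suc (Suc 0)) = s \<circ>\<^sub>J s" by (simp add: jone_right)
  have p3: "jpow s (Suc (Suc (Suc 0))) \<circ>\<^sub>J y = 3 *\<^sub>R (s \<circ>\<^sub>J ((s \<circ>\<^sub>J s) \<circ>\<^sub>J y)) - 2 *\<^sub>R (s \<circ>\<^sub>J (s \<circ>\<^sub>J (s \<circ>\<^sub>J y)))" for y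
  proof (rule vector_eq_from_inner)
    fix k
    show "inner (jpow s (Suc (Suc (Suc 0))) \<circ>\<^sub>J y) k
      = inner (3 *\<^sub>R (s \<circ>\<^sub>J ((s \<circ>\<^sub>J s) \<circ>\<^sub>J y)) - 2 *\<^sub>R (s \<circ>\<^sub>J (s \<circ>\<^sub>J (s \<circ>\<^sub>J y)))) k"
      unfolding jpow_recursion[of s "Suc 0" y]
      by (simp add: jone_right jordan_identity inner_add_left inner_diff_left)
  qed
  have "(s \<circ>\<^sub>J s) \<circ>\<^sub>J (s \<circ>\<^sub>J s) = jpow s (Suc (Suc (Suc (Suc 0))))"
    using jpow_add[of s 2 2] by (simp add: eval_nat_numeral jone_right)
  then have p4: "((s \<circ>\<^sub>J s) \<circ>\<^sub>J (s \<circ>\<^sub>J s)) \<circ>\<^sub>J y = (s \<circ>\<^sub>J s) \<circ>\<^sub>J ((s \<circ>\<^sub>J s) \<circ>\<^sub>J y)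
      + 2 *\<^sub>R (jpow s (Suc (Suc (Suc 0))) \<circ>\<^sub>J (s \<circ>\<^sub>J y)) - (s \<circ>\<^sub>J s) \<circ>\<^sub>J (s \<circ>\<^sub>J (s \<circ>\<^sub>J y))
      - s \<circ>\<^sub>J (s \<circ>\<^sub>J ((s \<circ>\<^sub>J s) \<circ>\<^sub>J y))" for y
    using jpow_recursion[of s "Suc (Suc 0)" y] unfolding p2 by simp
  show ?thesis
    unfolding quad_rep_def jL_def p4 p3
    by (rule vector_eq_from_inner)
       (simp add: jprod_linear_simps jordan_identity inner_add_left inner_diff_left)
qed

section \<open>Peirce rules for an idempotent\<close>

text \<open>
  Multiplication \<open>L\<close> by an idempotent satisfies \<open>L (2 L - 1) (L - 1) = 0\<close>: this is the
  polarised identity with two of its arguments equal to \<open>c\<close>.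
\<close>

lemma peirce_cubic:
  fixes c v :: "'a::euclidean_jordan_algebra"
  assumes "idempotent c"
  shows "2 *\<^sub>R (c \<circ>\<^sub>J (c \<circ>\<^sub>J (c \<circ>\<^sub>J v))) = 3 *\<^sub>R (c \<circ>\<^sub>J (c \<circ>\<^sub>J v)) - c \<circ>\<^sub>J v"
proof -
  have cc: "c \<circ>\<^sub>J c = c" using assms by (simp add: idempotent_def)
  show ?thesis
  proof (rule vector_eq_from_inner)
    fix k
    show "inner (2 *\<^sub>R (c \<circ>\<^sub>J (c \<circ>\<^sub>J (c \<circ>\<^sub>J v)))) k = inner (3 *\<^sub>R (c \<circ>\<^sub>J (c \<circ>\<^sub>J v)) - c \<circ>\<^sub>J v) k"
      using arg_cong[where f="\<lambda>v. inner v k", OF jordan_identity_polarized[of v c c]]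
      by (simp add: cc jprod_commute[of v c] jprod_commute[of "c \<circ>\<^sub>J v" c]
          inner_add_left inner_diff_left)
  qed
qed

lemma peirce_product:
  fixes c y z :: "'a::euclidean_jordan_algebra"
  assumes "idempotent c"
  shows "z \<circ>\<^sub>J (c \<circ>\<^sub>J y) + 2 *\<^sub>R (c \<circ>\<^sub>J ((c \<circ>\<^sub>J z) \<circ>\<^sub>J y)) = 2 *\<^sub>R ((c \<circ>\<^sub>J z) \<circ>\<^sub>J (c \<circ>\<^sub>J y)) + c \<circ>\<^sub>J (z \<circ>\<^sub>J y)"
  using jordan_identity_polarized[of z c y] assms by (simp add: idempotent_def)

lemma peirce_one_closed:
  fixes c y z :: "'a::euclidean_jordan_algebra"
  assumes "idempotent c" "c \<circ>\<^sub>J y = y" "c \<circ>\<^sub>J z = z"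
  shows "c \<circ>\<^sub>J (z \<circ>\<^sub>J y) = z \<circ>\<^sub>J y"
  using peirce_product[OF assms(1), of z y] assms(2,3) by (simp add: algebra_simps scaleR_2)

text \<open>
  The polarised identity at \<open>c\<close> with the two factors in either order says that \<open>c\<close> both
  annihilates and fixes the product.
\<close>

lemma peirce_one_zero_orthogonal:
  fixes c y z :: "'a::euclidean_jordan_algebra"
  assumes "idempotent c" "c \<circ>\<^sub>J y = 0" "c \<circ>\<^sub>J z = z"
  shows "z \<circ>\<^sub>J y = 0"
proof -
  have "c \<circ>\<^sub>J (z \<circ>\<^sub>J y) = 0"
    using peirce_product[OF assms(1), of z y] assms(2,3) by (simp add: jprod.zero_left jprod.zero_right scaleR_2)
  moreover have "c \<circ>\<^sub>J (y \<circ>\<^sub>J z) = y \<circ>\<^sub>J z"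
    using peirce_product[OF assms(1), of y z] assms(2,3) by (simp add: jprod.zero_left jprod.zero_right)
  ultimately show ?thesis by (simp add: jprod_commute)
qed

lemma orthogonal_idempotent_commute:
  fixes c c' v :: "'a::euclidean_jordan_algebra"
  assumes "idempotent c" "c \<circ>\<^sub>J c' = 0"
  shows "c' \<circ>\<^sub>J (c \<circ>\<^sub>J v) = c \<circ>\<^sub>J (c' \<circ>\<^sub>J v)"
  using peirce_product[OF assms(1), of c' v] assms(2) by (simp add: jprod.zero_left jprod.zero_right)

text \<open>
  Multiplication by \<open>c\<close> has eigenvalues 0, 1/2, 1.  The two squares below are the norms of the
  components of \<open>v\<close> in the last two eigenspaces.
\<close>

lemma idempotent_inner_eq:
  fixes c v :: "'a::euclidean_jordan_algebra"
  assumes "idempotent c"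
  shows "inner (c \<circ>\<^sub>J v) v = (norm (2 *\<^sub>R (c \<circ>\<^sub>J (c \<circ>\<^sub>J v)) - c \<circ>\<^sub>J v))\<^sup>2
      + (norm (4 *\<^sub>R (c \<circ>\<^sub>J v) - 4 *\<^sub>R (c \<circ>\<^sub>J (c \<circ>\<^sub>J v))))\<^sup>2 / 2"
proof -
  define L where "L = (\<lambda>x. c \<circ>\<^sub>J x)"
  have sa: "inner (L x) y = inner x (L y)" for x y by (simp add: L_def inner_jprod_assoc)
  have cub: "2 * inner (L (L (L y))) k = 3 * inner (L (L y)) k - inner (L y) k" for y k
    using arg_cong[where f="\<lambda>v. inner v k", OF peirce_cubic[OF assms, of y]]
    by (simp add: L_def inner_diff_left)
  have 1: "inner (L v) (L v) = inner (L (L v)) v" by (simp add: sa)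
  have 2: "inner (L (L v)) (L v) = inner (L (L (L v))) v" by (simp add: sa)
  have 3: "inner (L (L v)) (L (L v)) = inner (L (L (L (L v)))) v" by (simp add: sa)
  have 4: "inner (L v) (L (L v)) = inner (L (L (L v))) v" by (simp add: sa)
  show ?thesis
    using cub[of v v] cub[of "L v" v]
    unfolding L_def[symmetric] power2_norm_eq_inner
    by (simp add: inner_diff_left inner_diff_right 1 2 3 4 field_simps)
qed

lemma idempotent_inner_nonneg:
  fixes c v :: "'a::euclidean_jordan_algebra"
  assumes "idempotent c"
  shows "0 \<le> inner (c \<circ>\<^sub>J v) v"
  unfolding idempotent_inner_eq[OF assms] by simp

section \<open>Associative subalgebras are spanned by orthogonal idempotents\<close>

definition orthogonal_idempotents :: "'a::euclidean_jordan_algebra set \<Rightarrow> bool" where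
  "orthogonal_idempotents C \<longleftrightarrow> finite C \<and> (\<forall>c\<in>C. idempotent c \<and> c \<noteq> 0) \<and>
     (\<forall>a\<in>C. \<forall>b\<in>C. a \<noteq> b \<longrightarrow> a \<circ>\<^sub>J b = 0)"

definition assoc_subalgebra :: "'a::euclidean_jordan_algebra set \<Rightarrow> bool" where
  "assoc_subalgebra S \<longleftrightarrow> subspace S \<and> (\<forall>a\<in>S. \<forall>b\<in>S. a \<circ>\<^sub>J b \<in> S) \<and>
     (\<forall>a\<in>S. \<forall>b\<in>S. \<forall>c\<in>S. a \<circ>\<^sub>J (b \<circ>\<^sub>J c) = (a \<circ>\<^sub>J b) \<circ>\<^sub>J c)"

lemma jprod_self_eq_0_iff: "x \<circ>\<^sub>J x = 0 \<longleftrightarrow> x = (0::'a::euclidean_jordan_algebra)"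
proof
  assume "x \<circ>\<^sub>J x = 0"
  then have "inner (x \<circ>\<^sub>J x) jone = 0" by simp
  then show "x = 0" by (simp add: inner_jprod_assoc jone_right)
qed (simp add: jprod.zero_left)

text \<open>
  A maximiser of the Rayleigh quotient on the unit sphere of \<open>I\<close> is an eigenvector, because the
  quadratic form \<open>M |v|\<^sup>2 - (T v, v)\<close> is nonnegative and vanishes there.
\<close>

lemma selfadjoint_has_eigenvector:
  fixes T :: "'a::euclidean_space \<Rightarrow> 'a"
  assumes "linear T" and I: "subspace I" "I \<noteq> {0}" and TI: "\<And>v. v \<in> I \<Longrightarrow> T v \<in> I"
    and sa: "\<And>u v. inner (T u) v = inner u (T v)"
  shows "\<exists>v\<in>I. v \<noteq> 0 \<and> (\<exists>M. T v = M *\<^sub>R v)"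
proof -
  interpret T: linear T by fact
  define K where "K = I \<inter> sphere 0 1"
  have "compact K" unfolding K_def by (intro closed_Int_compact closed_subspace I compact_sphere)
  moreover have "K \<noteq> {}"
  proof -
    obtain x where "x \<in> I" "x \<noteq> 0" using I subspace_0[OF I(1)] by blast
    then have "(1 / norm x) *\<^sub>R x \<in> K" by (simp add: K_def subspace_scale[OF I(1)])
    then show ?thesis by blast
  qed
  moreover have "continuous_on K (\<lambda>v. inner (T v) v)"
    by (intro continuous_intros linear_continuous_on linear_conv_bounded_linear[THEN iffD1] assms(1))
  ultimately obtain v where v: "v \<in> K" and max: "\<And>u. u \<in> K \<Longrightarrow> inner (T u) u \<le> inner (T v) v"
    using continuous_attains_sup[of K "\<lambda>v. inner (T v) v"] by blast
  define M where "M = inner (T v) v"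
  have v1: "v \<in> I" "inner v v = 1" using v by (auto simp: K_def dot_square_norm)
  have le: "inner (T u) u \<le> M * inner u u" if "u \<in> I" for u
  proof (cases "u = 0")
    case False
    then have "(1 / norm u) *\<^sub>R u \<in> K" using that by (simp add: K_def subspace_scale[OF I(1)])
    from max[OF this] have "inner (T u) u / (norm u)^2 \<le> M"
      by (simp add: T.scaleR M_def power2_eq_square)
    then show ?thesis using False by (simp add: divide_le_eq dot_square_norm)
  qed (simp add: T.zero)
  define q where "q = T v - M *\<^sub>R v"
  have qI: "q \<in> I" unfolding q_def by (intro subspace_diff I subspace_scale TI v1)
  have qq: "inner q q = inner (T v) q - M * inner v q"
    unfolding q_def by (simp add: inner_diff_left)
  have "2 * t * inner q q \<le> t\<^sup>2 * (M * inner q q - inner (T q) q)" for t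
  proof -
    have "v + t *\<^sub>R q \<in> I" using v1 qI I by (simp add: subspace_add subspace_scale)
    from le[OF this] have "inner (T v) v + 2 * t * inner (T v) q + t\<^sup>2 * inner (T q) q
      \<le> M * (inner v v + 2 * t * inner v q + t\<^sup>2 * inner q q)"
      by (simp add: T.add T.scaleR inner_add_left inner_add_right sa[of q v] inner_commute[of q v] inner_commute[of q "T v"]
          power2_eq_square algebra_simps)
    then have "2 * t * (inner (T v) q - M * inner v q) \<le> t\<^sup>2 * (M * inner q q - inner (T q) q)"
      using v1 by (simp add: M_def algebra_simps)
    then show ?thesis unfolding qq[symmetric] .
  qed
  note quad = this
  have "inner q q \<le> 0"
  proof (rule ccontr)
    assume "\<not> inner q q \<le> 0"
    \<comment> \<open>At \<open>t = A / B\<close> the linear term of the inequality outweighs the quadratic one.\<close>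
    define A where "A = inner q q"
    define B where "B = \<bar>M * inner q q - inner (T q) q\<bar> + 1"
    have AB: "A > 0" "B > 0" using \<open>\<not> inner q q \<le> 0\<close> by (auto simp: A_def B_def)
    have "2 * (A/B) * A \<le> (A/B)\<^sup>2 * B"
    proof -
      have "M * inner q q - inner (T q) q \<le> B" by (simp add: B_def)
      from mult_left_mono[OF this, of "(A/B)\<^sup>2"] show ?thesis
        using quad[of "A/B"] by (simp only: A_def[symmetric]) simp
    qed
    then show False using AB by (simp add: power2_eq_square divide_le_cancel)
  qed
  then have "q = 0" using inner_ge_zero[of q] inner_eq_zero_iff[of q] by linarith
  then have "T v = M *\<^sub>R v" by (simp add: q_def)
  moreover have "v \<noteq> 0" using v1 by auto
  ultimately show ?thesis using v1 by blast
qed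

text \<open>
  On a minimal nonzero ideal every element of the algebra acts as a scalar, since its eigenspaces
  there are ideals; such an ideal is therefore the line through an idempotent.
\<close>

lemma assoc_subalgebra_line_ideal:
  fixes S :: "'a::euclidean_jordan_algebra set"
  assumes S: "assoc_subalgebra S" and "S \<noteq> {0}"
  shows "\<exists>c\<in>S. c \<noteq> 0 \<and> idempotent c \<and> (\<forall>s\<in>S. \<exists>l. s \<circ>\<^sub>J c = l *\<^sub>R c)"
proof -
  define ideal where "ideal = (\<lambda>I. subspace I \<and> I \<subseteq> S \<and> I \<noteq> {0} \<and> (\<forall>s\<in>S. \<forall>i\<in>I. s \<circ>\<^sub>J i \<in> I))"
  have sub: "subspace S" and cl: "\<And>a b. a \<in> S \<Longrightarrow> b \<in> S \<Longrightarrow> a \<circ>\<^sub>J b \<in> S"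
    and as: "\<And>a b c. a \<in> S \<Longrightarrow> b \<in> S \<Longrightarrow> c \<in> S \<Longrightarrow> a \<circ>\<^sub>J (b \<circ>\<^sub>J c) = (a \<circ>\<^sub>J b) \<circ>\<^sub>J c"
    using S by (auto simp: assoc_subalgebra_def)
  have "ideal S" using sub cl assms(2) by (auto simp: ideal_def)
  then obtain I where I: "ideal I" and min: "\<And>J. ideal J \<Longrightarrow> dim I \<le> dim J"
    using ex_has_least_nat[of ideal S dim] by blast
  have scalar: "\<exists>l. \<forall>i\<in>I. s \<circ>\<^sub>J i = l *\<^sub>R i" if s: "s \<in> S" for s
  proof -
    have "\<exists>v\<in>I. v \<noteq> 0 \<and> (\<exists>M. s \<circ>\<^sub>J v = M *\<^sub>R v)"
      using I s by (intro selfadjoint_has_eigenvector)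
        (auto simp: ideal_def inner_jprod_assoc jprod.bounded_linear_right bounded_linear.linear)
    then obtain v M where v: "v \<in> I" "v \<noteq> 0" "s \<circ>\<^sub>J v = M *\<^sub>R v" by blast
    define J where "J = {i\<in>I. s \<circ>\<^sub>J i = M *\<^sub>R i}"
    have "subspace J"
      using I unfolding J_def ideal_def
      by (auto simp: subspace_def jprod_linear_simps jprod.zero_right scaleR_add_right)
    moreover have "J \<noteq> {0}" using v by (auto simp: J_def)
    moreover have "t \<circ>\<^sub>J i \<in> J" if "t \<in> S" "i \<in> J" for t i
    proof -
      have i: "i \<in> I" "i \<in> S" "s \<circ>\<^sub>J i = M *\<^sub>R i" using that I by (auto simp: J_def ideal_def)
      have "s \<circ>\<^sub>J (t \<circ>\<^sub>J i) = t \<circ>\<^sub>J (s \<circ>\<^sub>J i)"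
        using as[OF s that(1) i(2)] as[OF that(1) s i(2)] by (simp add: jprod_commute)
      then have "s \<circ>\<^sub>J (t \<circ>\<^sub>J i) = M *\<^sub>R (t \<circ>\<^sub>J i)" by (simp add: i jprod_scaleR_right)
      then show ?thesis using i I that by (auto simp: J_def ideal_def)
    qed
    ultimately have "ideal J" using I by (auto simp: ideal_def J_def)
    then have "J = I"
      using min[of J] \<open>subspace J\<close> I by (intro subspace_dim_equal) (auto simp: ideal_def J_def)
    then show ?thesis unfolding J_def by blast
  qed
  obtain a where a: "a \<in> I" "a \<noteq> 0" using I subspace_0 by (auto simp: ideal_def)
  have aS: "a \<in> S" using a I by (auto simp: ideal_def)
  obtain l where l: "\<And>i. i \<in> I \<Longrightarrow> a \<circ>\<^sub>J i = l *\<^sub>R i" using scalar[OF aS] by blast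
  have "l \<noteq> 0" using l[OF a(1)] a jprod_self_eq_0_iff[of a] by auto
  define c where "c = (1/l) *\<^sub>R a"
  have cI: "c \<in> I" using a I by (auto simp: c_def ideal_def subspace_scale)
  have "idempotent c" using l[OF a(1)] \<open>l \<noteq> 0\<close>
    by (simp add: idempotent_def c_def jprod_linear_simps)
  moreover have "c \<noteq> 0" using \<open>l \<noteq> 0\<close> a by (simp add: c_def)
  moreover have "\<forall>s\<in>S. \<exists>l. s \<circ>\<^sub>J c = l *\<^sub>R c" using scalar cI by blast
  moreover have "c \<in> S" using cI I by (auto simp: ideal_def)
  ultimately show ?thesis by blast
qed

lemma assoc_subalgebra_idempotent_basis:
  fixes S :: "'a::euclidean_jordan_algebra set"
  assumes "assoc_subalgebra S"
  shows "\<exists>C. orthogonal_idempotents C \<and> span C = S"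
  using assms
proof (induction "dim S" arbitrary: S rule: less_induct)
  case less
  show ?case
  proof (cases "S = {0}")
    case True
    then show ?thesis by (intro exI[of _ "{}"]) (auto simp: orthogonal_idempotents_def)
  next
    case False
    obtain c where c: "c \<in> S" "c \<noteq> 0" "idempotent c"
      and l: "\<And>s. s \<in> S \<Longrightarrow> \<exists>l. s \<circ>\<^sub>J c = l *\<^sub>R c"
      using assoc_subalgebra_line_ideal[OF less.prems False] by blast
    have sub: "subspace S" and cl: "\<And>a b. a \<in> S \<Longrightarrow> b \<in> S \<Longrightarrow> a \<circ>\<^sub>J b \<in> S"
      and as: "\<And>a b c. a \<in> S \<Longrightarrow> b \<in> S \<Longrightarrow> c \<in> S \<Longrightarrow> a \<circ>\<^sub>J (b \<circ>\<^sub>J c) = (a \<circ>\<^sub>J b) \<circ>\<^sub>J c"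
      using less.prems by (auto simp: assoc_subalgebra_def)
    define R where "R = {s\<in>S. s \<circ>\<^sub>J c = 0}"
    have subR: "subspace R" using sub
      by (auto simp: R_def subspace_def jprod_linear_simps jprod.zero_left)
    have "assoc_subalgebra R"
      unfolding assoc_subalgebra_def
    proof (intro conjI ballI)
      show "a \<circ>\<^sub>J b \<in> R" if "a \<in> R" "b \<in> R" for a b
        using that c cl as[of a b c] by (auto simp: R_def jprod.zero_right)
    qed (use subR as in \<open>auto simp: R_def\<close>)
    moreover have "dim R < dim S"
    proof (rule dim_psubset)
      have "c \<notin> R" using c by (auto simp: R_def idempotent_def)
      then show "span R \<subset> span S"
        using c(1) subR sub by (metis R_def mem_Collect_eq psubsetI span_eq_iff subsetI)
    qed
    ultimately obtain C where C: "orthogonal_idempotents C" "span C = R" using less.hyps by blast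
    have CR: "d \<circ>\<^sub>J c = 0" "d \<in> S" if "d \<in> C" for d
      using that C(2) span_base[of d C] by (auto simp: R_def)
    have "orthogonal_idempotents (insert c C)"
      using C(1) c CR CR(1)[simplified jprod_commute[of _ c]] by (auto simp: orthogonal_idempotents_def)
    moreover have "span (insert c C) = S"
    proof
      show "span (insert c C) \<subseteq> S" using c CR sub by (intro span_minimal) auto
      show "S \<subseteq> span (insert c C)"
      proof
        fix s assume s: "s \<in> S"
        obtain l where "s \<circ>\<^sub>J c = l *\<^sub>R c" using l[OF s] by blast
        then have "s - l *\<^sub>R c \<in> R"
          using s c sub by (auto simp: R_def jprod_linear_simps subspace_diff subspace_scale idempotent_def)
        then show "s \<in> span (insert c C)" using C(2) span_insert by blast
      qed
    qed
    ultimately show ?thesis by blast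
  qed
qed

text \<open>
  With \<open>k = 0\<close> this is the algebra generated by \<open>x\<close> and the identity; \<open>k = 1\<close> leaves the
  identity out, which keeps the algebra inside a Peirce space.
\<close>

lemma assoc_subalgebra_powers:
  fixes x :: "'a::euclidean_jordan_algebra"
  shows "assoc_subalgebra (span (jpow x ` {k..}))" (is "assoc_subalgebra (span ?P)")
proof -
  have PP: "a \<circ>\<^sub>J b \<in> ?P" if "a \<in> ?P" "b \<in> ?P" for a b
    using that by (auto simp: jpow_add)
  have 1: "a \<circ>\<^sub>J b \<in> span ?P" if "a \<in> ?P" "b \<in> span ?P" for a b
    using that(2) by (induction rule: span_induct_alt)
      (auto simp: jprod.zero_right jprod_linear_simps intro!: span_add span_scale span_base[OF PP[OF that(1)]] span_zero)
  have cl: "a \<circ>\<^sub>J b \<in> span ?P" if "a \<in> span ?P" "b \<in> span ?P" for a b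
    using that(1) by (induction rule: span_induct_alt)
      (auto simp: jprod.zero_left jprod_linear_simps intro!: span_add span_scale 1 that span_zero)
  have a3: "a \<circ>\<^sub>J (b \<circ>\<^sub>J c) = (a \<circ>\<^sub>J b) \<circ>\<^sub>J c" if "a \<in> ?P" "b \<in> ?P" "c \<in> ?P" for a b c
    using that by (auto simp: jpow_add add.assoc)
  have a2: "a \<circ>\<^sub>J (b \<circ>\<^sub>J c) = (a \<circ>\<^sub>J b) \<circ>\<^sub>J c" if "a \<in> ?P" "b \<in> ?P" "c \<in> span ?P" for a b c
    using that(3) by (induction rule: span_induct_alt)
      (auto simp: jprod.zero_right jprod_linear_simps a3[OF that(1,2)])
  have a1: "a \<circ>\<^sub>J (b \<circ>\<^sub>J c) = (a \<circ>\<^sub>J b) \<circ>\<^sub>J c" if "a \<in> ?P" "b \<in> span ?P" "c \<in> span ?P" for a b c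
    using that(2) by (induction rule: span_induct_alt)
      (auto simp: jprod.zero_right jprod.zero_left jprod_linear_simps a2[OF that(1) _ that(3)])
  have a0: "a \<circ>\<^sub>J (b \<circ>\<^sub>J c) = (a \<circ>\<^sub>J b) \<circ>\<^sub>J c" if "a \<in> span ?P" "b \<in> span ?P" "c \<in> span ?P" for a b c
    using that(1) by (induction rule: span_induct_alt)
      (auto simp: jprod.zero_right jprod.zero_left jprod_linear_simps a1[OF _ that(2,3)])
  show ?thesis unfolding assoc_subalgebra_def using cl a0 by auto
qed

section \<open>Jordan frames and the spectral decomposition\<close>

lemma orthogonal_idempotents_independent:
  fixes C :: "'a::euclidean_jordan_algebra set"
  assumes "orthogonal_idempotents C"
  shows "independent C"
proof (rule pairwise_orthogonal_independent)
  have "inner a b = 0" if "a \<in> C" "b \<in> C" "a \<noteq> b" for a b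
  proof -
    have "inner (a \<circ>\<^sub>J a) b = inner a (a \<circ>\<^sub>J b)" by (rule inner_jprod_assoc)
    then show ?thesis using that assms by (auto simp: orthogonal_idempotents_def idempotent_def)
  qed
  then show "pairwise orthogonal C" by (auto simp: pairwise_def orthogonal_def)
qed (use assms in \<open>auto simp: orthogonal_idempotents_def\<close>)

lemma orthogonal_idempotents_prod_sum:
  fixes C :: "'a::euclidean_jordan_algebra set"
  assumes "orthogonal_idempotents C"
  shows "(\<Sum>c\<in>C. f c *\<^sub>R c) \<circ>\<^sub>J (\<Sum>c\<in>C. g c *\<^sub>R c) = (\<Sum>c\<in>C. (f c * g c) *\<^sub>R c)"
proof -
  have "f a *\<^sub>R a \<circ>\<^sub>J (\<Sum>c\<in>C. g c *\<^sub>R c) = (f a * g a) *\<^sub>R a" if a: "a \<in> C" for a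
  proof -
    have "f a *\<^sub>R a \<circ>\<^sub>J (\<Sum>c\<in>C. g c *\<^sub>R c) = (\<Sum>c\<in>C. if c = a then (f a * g a) *\<^sub>R a else 0)"
      unfolding jprod.sum_right
      using assms a by (intro sum.cong)
        (auto simp: jprod_linear_simps orthogonal_idempotents_def idempotent_def)
    also have "\<dots> = (f a * g a) *\<^sub>R a"
      using assms a by (simp add: orthogonal_idempotents_def)
    finally show ?thesis .
  qed
  then show ?thesis unfolding jprod.sum_left by (rule sum.cong[OF refl])
qed

lemma idempotent_summands_orthogonal:
  fixes a b :: "'a::euclidean_jordan_algebra"
  assumes "idempotent a" "idempotent b" "idempotent (a + b)"
  shows "a \<circ>\<^sub>J b = 0"
proof -
  have "2 *\<^sub>R (a \<circ>\<^sub>J b) = 0"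
    using assms by (simp add: idempotent_def jprod_linear_simps jprod_commute[of b a] scaleR_2)
  then show ?thesis by simp
qed

text \<open>
  The idempotents are those of the algebra generated by \<open>x\<close>, refined as long as possible;
  refinement stops because orthogonal idempotents are linearly independent.
\<close>

lemma spectral_decomp_exists:
  fixes x :: "'a::euclidean_jordan_algebra"
  shows "\<exists>C ev. spectral_decomp x C ev"
proof -
  define good where "good = (\<lambda>C. orthogonal_idempotents C \<and> (\<Sum>c\<in>C. c) = jone \<and> x \<in> span C)"
  have "\<exists>C. good C"
  proof -
    obtain C where C: "orthogonal_idempotents C" "span C = span (jpow x ` {0..})"
      using assoc_subalgebra_idempotent_basis[OF assoc_subalgebra_powers] by blast
    have fin: "finite C" using C by (simp add: orthogonal_idempotents_def)
    have "jpow x 0 \<in> span C" "jpow x (Suc 0) \<in> span C"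
      unfolding C(2) by (rule span_base, blast)+
    then have e: "jone \<in> span C" and x: "x \<in> span C" by (simp_all add: jone_right)
    obtain f where f: "jone = (\<Sum>c\<in>C. f c *\<^sub>R c)" using e unfolding span_finite[OF fin] by auto
    \<comment> \<open>Multiplying the expansion of the identity by a member of the system isolates its coefficient.\<close>
    have "f a = 1" if a: "a \<in> C" for a
    proof -
      have "a = jone \<circ>\<^sub>J (\<Sum>c\<in>C. (if c = a then 1 else 0) *\<^sub>R c)"
        using fin a by (simp add: jone_left if_distrib[of "\<lambda>t. t *\<^sub>R _"] cong: if_cong)
      also have "\<dots> = (\<Sum>c\<in>C. (f c * (if c = a then 1 else 0)) *\<^sub>R c)"
        unfolding f by (rule orthogonal_idempotents_prod_sum[OF C(1)])
      also have "\<dots> = f a *\<^sub>R a" using fin a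
        by (simp add: if_distrib[of "\<lambda>t. t *\<^sub>R _"] if_distrib[of "\<lambda>t. _ * t"] cong: if_cong)
      finally have "(1 - f a) *\<^sub>R a = 0" by (simp add: algebra_simps)
      then show ?thesis using a C(1) by (auto simp: orthogonal_idempotents_def)
    qed
    then have "(\<Sum>c\<in>C. c) = jone" unfolding f by simp
    then show ?thesis using C x by (auto simp: good_def)
  qed
  then obtain C0 where C0: "good C0" by blast
  have "\<forall>C. good C \<longrightarrow> card C < Suc DIM('a)"
    using orthogonal_idempotents_independent independent_bound by (auto simp: good_def less_Suc_eq_le)
  from ex_has_greatest_nat[OF C0 this]
  obtain C where C: "good C" and max: "\<And>D. good D \<Longrightarrow> card D \<le> card C" by blast
  have oi: "orthogonal_idempotents C" using C by (simp add: good_def)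
  have fin: "finite C" using oi by (simp add: orthogonal_idempotents_def)
  have "primitive_idempotent c" if c: "c \<in> C" for c
  proof (rule ccontr)
    assume "\<not> primitive_idempotent c"
    then obtain a b where ab: "idempotent a" "idempotent b" "a \<noteq> 0" "b \<noteq> 0" "c = a + b"
      using c oi by (auto simp: primitive_idempotent_def orthogonal_idempotents_def)
    have ci: "idempotent c" using c oi by (auto simp: orthogonal_idempotents_def)
    have ab0: "a \<circ>\<^sub>J b = 0" "b \<circ>\<^sub>J a = 0"
      using idempotent_summands_orthogonal[of a b] ab ci by (auto simp: jprod_commute)
    have ca: "c \<circ>\<^sub>J a = a" and cb: "c \<circ>\<^sub>J b = b"
      using ab ab0 by (auto simp: jprod_linear_simps idempotent_def)
    have az: "a \<circ>\<^sub>J d = 0" "b \<circ>\<^sub>J d = 0" "d \<circ>\<^sub>J a = 0" "d \<circ>\<^sub>J b = 0" if "d \<in> C - {c}" for d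
    proof -
      have cd: "c \<circ>\<^sub>J d = 0" using that c oi by (auto simp: orthogonal_idempotents_def)
      show "a \<circ>\<^sub>J d = 0" "b \<circ>\<^sub>J d = 0"
        using peirce_one_zero_orthogonal[OF ci cd ca] peirce_one_zero_orthogonal[OF ci cd cb] by auto
      then show "d \<circ>\<^sub>J a = 0" "d \<circ>\<^sub>J b = 0" by (simp_all add: jprod_commute)
    qed
    have "a \<noteq> b" using ab(1,3) ab0(1) by (auto simp: idempotent_def)
    moreover have "a \<notin> C - {c}" using az(1)[of a] ab(1,3) by (metis idempotent_def)
    moreover have "b \<notin> C - {c}" using az(2)[of b] ab(2,4) by (metis idempotent_def)
    ultimately have ne: "a \<noteq> b" "a \<notin> C - {c}" "b \<notin> C - {c}" by blast+
    define D where "D = insert a (insert b (C - {c}))"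
    have "x \<circ>\<^sub>J y = 0" if "x \<in> D" "y \<in> D" "x \<noteq> y" for x y
    proof -
      have "x \<circ>\<^sub>J y = 0" if "x \<in> C - {c}" "y \<in> C - {c}"
        using that \<open>x \<noteq> y\<close> oi by (auto simp: orthogonal_idempotents_def)
      then show ?thesis using that ab0 az unfolding D_def by (elim insertE) simp_all
    qed
    moreover have "finite D" using fin by (simp add: D_def)
    moreover have "idempotent x \<and> x \<noteq> 0" if "x \<in> D" for x
      using that ab oi unfolding D_def orthogonal_idempotents_def by blast
    ultimately have "orthogonal_idempotents D" unfolding orthogonal_idempotents_def by blast
    moreover have "(\<Sum>c\<in>D. c) = jone"
    proof -
      have "(\<Sum>c\<in>D. c) = a + (b + (\<Sum>c\<in>C-{c}. c))"
        using ne fin by (simp add: D_def)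
      also have "\<dots> = (\<Sum>c\<in>C. c)" using sum.remove[OF fin c, of "\<lambda>c. c"] ab(5) by simp
      finally show ?thesis using C by (simp add: good_def)
    qed
    moreover have "x \<in> span D"
    proof -
      have "d \<in> span D" if "d \<in> C" for d
      proof (cases "d = c")
        case True
        then show ?thesis unfolding True ab(5) by (intro span_add span_base) (auto simp: D_def)
      qed (use that in \<open>auto simp: D_def intro!: span_base\<close>)
      then have "span C \<subseteq> span D" by (intro span_minimal) auto
      then show ?thesis using C by (auto simp: good_def)
    qed
    ultimately have "card D \<le> card C" by (intro max) (simp add: good_def)
    moreover have "card D = Suc (card C)"
      using ne fin card_Suc_Diff1[OF fin c] by (simp add: D_def del: Diff_iff)
    ultimately show False by simp
  qed
  then have "jordan_frame C" using C by (auto simp: good_def jordan_frame_def orthogonal_idempotents_def)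
  moreover obtain f where "x = (\<Sum>c\<in>C. f c *\<^sub>R c)"
    using C unfolding good_def span_finite[OF fin] by auto
  ultimately show ?thesis by (auto simp: spectral_decomp_def)
qed

lemma jordan_frame_orthogonal_idempotents: "jordan_frame C \<Longrightarrow> orthogonal_idempotents C"
  by (auto simp: jordan_frame_def orthogonal_idempotents_def primitive_idempotent_def)

text \<open>
  The algebra generated by \<open>x\<close> without the identity stays in the Peirce space of \<open>c\<close>.  Any
  idempotent \<open>d\<close> in it splits \<open>c\<close> as \<open>d + (c - d)\<close>, so primitivity forces \<open>d = c\<close>.
\<close>

lemma primitive_peirce_one:
  fixes c x :: "'a::euclidean_jordan_algebra"
  assumes c: "primitive_idempotent c" and x: "c \<circ>\<^sub>J x = x"
  shows "\<exists>l. x = l *\<^sub>R c"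
proof -
  have ci: "idempotent c" using c by (simp add: primitive_idempotent_def)
  obtain C where C: "orthogonal_idempotents C" "span C = span (jpow x ` {1..})"
    using assoc_subalgebra_idempotent_basis[OF assoc_subalgebra_powers] by blast
  have pw: "c \<circ>\<^sub>J jpow x (Suc n) = jpow x (Suc n)" for n
    by (induction n) (use x in \<open>auto simp: jone_right intro!: peirce_one_closed[OF ci]\<close>)
  have unit: "c \<circ>\<^sub>J s = s" if "s \<in> span (jpow x ` {1..})" for s
    using that
  proof (induction rule: span_induct_alt)
    case (step t y z)
    then obtain n where "y = jpow x (Suc n)" by (auto simp: Suc_le_eq gr0_conv_Suc)
    then show ?case using step pw by (simp add: jprod_linear_simps del: jpow.simps)
  qed (simp add: jprod.zero_right)
  have "d = c" if d: "d \<in> C" for d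
  proof -
    have di: "idempotent d" "d \<noteq> 0" using d C by (auto simp: orthogonal_idempotents_def)
    have cd: "c \<circ>\<^sub>J d = d" using unit[of d] d C(2) span_base[of d C] by auto
    have "idempotent (c - d)"
      using ci di cd by (simp add: idempotent_def jprod_linear_simps jprod_commute[of d c])
    then have "c - d = 0" using c di unfolding primitive_idempotent_def
      by (metis add.commute diff_add_cancel)
    then show ?thesis by simp
  qed
  then have "C \<subseteq> {c}" by auto
  then have "span C \<subseteq> span {c}" by (rule span_mono)
  moreover have "jpow x (Suc 0) \<in> span C" unfolding C(2) by (intro span_base imageI) simp
  ultimately have "x \<in> span {c}" by (auto simp: jone_right)
  then show ?thesis by (auto simp: span_singleton)
qed

section \<open>The trace\<close>

text \<open>
  Because \<open>b\<close> is primitive, \<open>P(b) a = m b\<close> with \<open>m = (a, b) / |b|\<^sup>2\<close>.  Pairing with \<open>a\<close> gives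
  \<open>2 |a \<circ> b|\<^sup>2 = (a, b) (1 + m)\<close>.  The left side is symmetric in \<open>a\<close> and \<open>b\<close>, so \<open>m\<close> is symmetric
  too as soon as \<open>(a, b)\<close> is nonzero.
\<close>

lemma primitive_idempotents_same_norm:
  fixes a b :: "'a::euclidean_jordan_algebra"
  assumes a: "primitive_idempotent a" and b: "primitive_idempotent b" and ne: "inner a b \<noteq> 0"
  shows "inner a a = inner b b"
proof -
  have key: "2 * inner (a \<circ>\<^sub>J b) (a \<circ>\<^sub>J b) * inner b b = inner a b * (inner b b + inner a b)"
    if "primitive_idempotent a" "primitive_idempotent b" for a b :: 'a
  proof -
    have ai: "a \<circ>\<^sub>J a = a" and bi: "b \<circ>\<^sub>J b = b" "idempotent b"
      using that by (auto simp: primitive_idempotent_def idempotent_def)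
    have "b \<circ>\<^sub>J (2 *\<^sub>R (b \<circ>\<^sub>J (b \<circ>\<^sub>J a)) - b \<circ>\<^sub>J a) = 2 *\<^sub>R (b \<circ>\<^sub>J (b \<circ>\<^sub>J a)) - b \<circ>\<^sub>J a"
    proof (rule vector_eq_from_inner)
      fix k
      show "inner (b \<circ>\<^sub>J (2 *\<^sub>R (b \<circ>\<^sub>J (b \<circ>\<^sub>J a)) - b \<circ>\<^sub>J a)) k = inner (2 *\<^sub>R (b \<circ>\<^sub>J (b \<circ>\<^sub>J a)) - b \<circ>\<^sub>J a) k"
        using arg_cong[where f="\<lambda>v. inner v k", OF peirce_cubic[OF bi(2), of a]]
        by (simp add: jprod_linear_simps inner_diff_left)
    qed
    from primitive_peirce_one[OF that(2) this]
    obtain m where m: "2 *\<^sub>R (b \<circ>\<^sub>J (b \<circ>\<^sub>J a)) - b \<circ>\<^sub>J a = m *\<^sub>R b" by blast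
    have bb: "inner (b \<circ>\<^sub>J x) b = inner x b" for x by (simp add: inner_jprod_assoc bi)
    have "m * inner b b = inner a b"
      using arg_cong[where f="\<lambda>v. inner v b", OF m] by (simp add: inner_diff_left bb)
    moreover have "2 * inner (a \<circ>\<^sub>J b) (a \<circ>\<^sub>J b) - inner a b = m * inner a b"
    proof -
      have "inner (b \<circ>\<^sub>J (b \<circ>\<^sub>J a)) a = inner (a \<circ>\<^sub>J b) (a \<circ>\<^sub>J b)"
        by (simp add: inner_jprod_assoc jprod_commute)
      moreover have "inner (b \<circ>\<^sub>J a) a = inner a b"
        by (simp add: jprod_commute[of b a] inner_jprod_assoc ai inner_commute[of b a])
      ultimately show ?thesis
        using arg_cong[where f="\<lambda>v. inner v a", OF m] by (simp add: inner_diff_left inner_commute[of b a])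
    qed
    ultimately have "2 * inner (a \<circ>\<^sub>J b) (a \<circ>\<^sub>J b) * inner b b
        = (inner a b + m * inner a b) * inner b b" and "m * inner b b = inner a b" by simp_all
    then show ?thesis by (simp add: algebra_simps)
  qed
  have pos: "inner a a > 0" "inner b b > 0" using a b by (auto simp: primitive_idempotent_def)
  define q where "q = 2 * inner (a \<circ>\<^sub>J b) (a \<circ>\<^sub>J b)"
  have "q * inner b b = inner a b * (inner b b + inner a b)"
    "q * inner a a = inner a b * (inner a a + inner a b)"
    using key[OF a b] key[OF b a] by (simp_all add: q_def jprod_commute[of b a] inner_commute[of b a])
  then have "inner a b * (inner b b + inner a b) * inner a a = inner a b * (inner a a + inner a b) * inner b b"
    by (metis mult.assoc mult.commute)
  then have "inner a b * inner a b * (inner a a - inner b b) = 0" by (simp add: algebra_simps)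
  then show ?thesis using ne by simp
qed

text \<open>
  The vector that represents the trace with respect to the ambient inner product.  It is the
  identity up to scale on each simple ideal, and need not be a multiple of the identity.
\<close>

definition trace_vector :: "'a::euclidean_jordan_algebra" where
  "trace_vector = (\<Sum>c\<in>(SOME C. jordan_frame C). (1 / inner c c) *\<^sub>R c)"

lemma jordan_frame_exists: "\<exists>C :: 'a::euclidean_jordan_algebra set. jordan_frame C"
  using spectral_decomp_exists[of 0] by (auto simp: spectral_decomp_def)

text \<open>
  Every primitive idempotent \<open>d\<close> meets only frame members of its own norm, so the weights
  \<open>1 / |c|\<^sup>2\<close> add up its components to \<open>(e, d) / |d|\<^sup>2 = 1\<close>.
\<close>

lemma inner_frame_weights:
  fixes C :: "'a::euclidean_jordan_algebra set"
  assumes C: "jordan_frame C" and d: "primitive_idempotent d"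
  shows "inner (\<Sum>c\<in>C. (1 / inner c c) *\<^sub>R c) d = 1"
proof -
  have "inner (\<Sum>c\<in>C. (1 / inner c c) *\<^sub>R c) d = (\<Sum>c\<in>C. inner c d / inner d d)"
    unfolding inner_sum_left
  proof (rule sum.cong[OF refl])
    fix c assume "c \<in> C"
    then show "inner ((1 / inner c c) *\<^sub>R c) d = inner c d / inner d d"
      using primitive_idempotents_same_norm[of c d] C d
      by (cases "inner c d = 0") (auto simp: jordan_frame_def)
  qed
  also have "\<dots> = inner jone d / inner d d"
    using C by (simp add: jordan_frame_def inner_sum_left[symmetric] sum_divide_distrib[symmetric])
  also have "inner jone d = inner d d"
    using d inner_jprod_assoc[of d jone d] by (simp add: jone_right primitive_idempotent_def idempotent_def)
  finally show ?thesis using d by (simp add: primitive_idempotent_def)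
qed

lemma inner_trace_vector_primitive:
  fixes d :: "'a::euclidean_jordan_algebra"
  assumes "primitive_idempotent d"
  shows "inner trace_vector d = 1"
  unfolding trace_vector_def
  by (rule inner_frame_weights[OF someI_ex[OF jordan_frame_exists] assms])

lemma inner_trace_vector:
  fixes x :: "'a::euclidean_jordan_algebra"
  assumes "spectral_decomp x C ev"
  shows "inner trace_vector x = (\<Sum>c\<in>C. ev c)"
  using assms
  by (auto simp: spectral_decomp_def jordan_frame_def inner_sum_right inner_trace_vector_primitive
      intro!: sum.cong)

lemma jtr_eq_inner: "jtr x = inner trace_vector (x :: 'a::euclidean_jordan_algebra)"
proof -
  obtain C ev where "spectral_decomp x C ev" using spectral_decomp_exists by blast
  then show ?thesis
    unfolding jtr_def using inner_trace_vector[of x] by (intro the_equality) metis+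
qed

lemma jtr_spectral: "spectral_decomp x C ev \<Longrightarrow> jtr x = (\<Sum>c\<in>C. ev c)"
  by (simp add: jtr_eq_inner inner_trace_vector)

lemma spectral_decomp_jone: "jordan_frame C \<Longrightarrow> spectral_decomp jone C (\<lambda>_. 1)"
  by (simp add: spectral_decomp_def jordan_frame_def)

lemma card_jordan_frame:
  fixes C :: "'a::euclidean_jordan_algebra set"
  assumes "jordan_frame C"
  shows "card C = jrank TYPE('a)"
proof -
  have "card D = card C" if D: "jordan_frame D" for D :: "'a set"
    using jtr_spectral[OF spectral_decomp_jone[OF D]] jtr_spectral[OF spectral_decomp_jone[OF assms]]
    by simp
  then show ?thesis unfolding jrank_def using assms by (intro the_equality[symmetric]) blast+
qed

lemma jtr_jone: "jtr (jone::'a::euclidean_jordan_algebra) = real (jrank TYPE('a))"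
proof -
  obtain C :: "'a set" where C: "jordan_frame C" using jordan_frame_exists by blast
  show ?thesis using jtr_spectral[OF spectral_decomp_jone[OF C]] card_jordan_frame[OF C] by simp
qed

lemma jrank_pos: "0 < jrank TYPE('a::euclidean_jordan_algebra)"
proof -
  obtain C :: "'a set" where C: "jordan_frame C" using jordan_frame_exists by blast
  have "jone \<noteq> (0::'a)"
  proof
    assume "jone = (0::'a)"
    then have "x = 0" for x :: 'a using jone_left[of x] by (simp add: jprod.zero_left)
    then show False using nonempty_Basis nonzero_Basis by blast
  qed
  then have "C \<noteq> {}" using C by (auto simp: jordan_frame_def)
  then show ?thesis using C card_jordan_frame[OF C] by (auto simp: jordan_frame_def card_gt_0_iff)
qed

text \<open>
  Since \<^const>\<open>trace_vector\<close> does not depend on the frame, it may be expanded in a frame that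
  diagonalises \<open>x\<close>.
\<close>

lemma trace_vector_frame:
  fixes C :: "'a::euclidean_jordan_algebra set"
  assumes "jordan_frame C"
  shows "trace_vector = (\<Sum>c\<in>C. (1 / inner c c) *\<^sub>R c)"
proof (rule vector_eq_from_inner)
  fix x :: 'a
  obtain D ev where D: "spectral_decomp x D ev" using spectral_decomp_exists by blast
  have "inner (\<Sum>c\<in>C. (1 / inner c c) *\<^sub>R c) x = (\<Sum>d\<in>D. ev d)"
    using D inner_frame_weights[OF assms]
    by (auto simp: spectral_decomp_def jordan_frame_def inner_sum_right intro!: sum.cong)
  then show "inner trace_vector x = inner (\<Sum>c\<in>C. (1 / inner c c) *\<^sub>R c) x"
    using inner_trace_vector[OF D] by simp
qed

lemma trace_vector_prod_frame:
  fixes C :: "'a::euclidean_jordan_algebra set"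
  assumes "jordan_frame C"
  shows "trace_vector \<circ>\<^sub>J (\<Sum>c\<in>C. f c *\<^sub>R c) = (\<Sum>c\<in>C. (f c / inner c c) *\<^sub>R c)"
  unfolding trace_vector_frame[OF assms]
  by (simp add: orthogonal_idempotents_prod_sum[OF jordan_frame_orthogonal_idempotents[OF assms]])

lemma trace_vector_square:
  fixes x :: "'a::euclidean_jordan_algebra"
  shows "trace_vector \<circ>\<^sub>J (x \<circ>\<^sub>J x) = x \<circ>\<^sub>J (trace_vector \<circ>\<^sub>J x)"
proof -
  obtain C ev where C: "jordan_frame C" and x: "x = (\<Sum>c\<in>C. ev c *\<^sub>R c)"
    using spectral_decomp_exists[of x] by (auto simp: spectral_decomp_def)
  note oi = jordan_frame_orthogonal_idempotents[OF C]
  show ?thesis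
    unfolding x orthogonal_idempotents_prod_sum[OF oi] trace_vector_prod_frame[OF C] by simp
qed

text \<open>
  Polarising \<open>z x\<^sup>2 = x (z x)\<close> and pairing with a third vector gives a linear relation
  between the three numbers \<open>(x y, z w)\<close>; with its permutations it makes them equal.
\<close>

lemma jtr_assoc:
  fixes x y w :: "'a::euclidean_jordan_algebra"
  shows "jtr ((x \<circ>\<^sub>J y) \<circ>\<^sub>J w) = jtr (y \<circ>\<^sub>J (x \<circ>\<^sub>J w))"
proof -
  let ?z = "trace_vector :: 'a"
  have lin: "2 *\<^sub>R (?z \<circ>\<^sub>J (x \<circ>\<^sub>J y)) = x \<circ>\<^sub>J (?z \<circ>\<^sub>J y) + y \<circ>\<^sub>J (?z \<circ>\<^sub>J x)" for x y :: 'a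
    using trace_vector_square[of "x+y"] trace_vector_square[of x] trace_vector_square[of y]
    by (simp add: jprod_linear_simps jprod_commute[of y x] scaleR_2 algebra_simps)
  define A where "A = (\<lambda>x y w. inner (x \<circ>\<^sub>J y) (?z \<circ>\<^sub>J w))"
  have A: "2 * A x y w = A x w y + A y w x" for x y w
  proof -
    have "inner (?z \<circ>\<^sub>J (x \<circ>\<^sub>J y)) w = A x y w" by (simp add: A_def inner_jprod_assoc_right)
    moreover have "inner (x \<circ>\<^sub>J (?z \<circ>\<^sub>J y)) w = A x w y" for x y
      by (simp add: A_def inner_jprod_assoc inner_commute)
    ultimately show ?thesis
      using arg_cong[where f="\<lambda>v. inner v w", OF lin[of x y]] by (simp add: inner_add_left)
  qed
  have sym: "A x y w = A y x w" for x y w by (simp add: A_def jprod_commute)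
  have "A x y w = A x w y"
    using A[of x y w] A[of x w y] sym[of w y x] by simp
  moreover have "jtr ((x \<circ>\<^sub>J y) \<circ>\<^sub>J w) = A x y w"
    by (simp add: jtr_eq_inner A_def inner_jprod_assoc_right jprod_commute[of "x \<circ>\<^sub>J y" ?z])
  moreover have "jtr (y \<circ>\<^sub>J (x \<circ>\<^sub>J w)) = A x w y"
    by (simp only: jtr_eq_inner A_def inner_jprod_assoc_right[of ?z y] jprod_commute[of y ?z]
        inner_commute[of "?z \<circ>\<^sub>J y"])
  ultimately show ?thesis by simp
qed

lemma linear_jtr: "linear (jtr :: 'a::euclidean_jordan_algebra \<Rightarrow> real)"
  by (auto intro!: linearI simp: jtr_eq_inner inner_add_right)

lemmas jtr_linear_simps =
  linear_add[OF linear_jtr] linear_diff[OF linear_jtr] linear_scale[OF linear_jtr]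
  linear_0[OF linear_jtr] linear_sum[OF linear_jtr] linear_neg[OF linear_jtr]

lemma jinner_assoc: "jinner (x \<circ>\<^sub>J y) w = jinner y (x \<circ>\<^sub>J (w::'a::euclidean_jordan_algebra))"
  unfolding jinner_def by (rule jtr_assoc)

lemma jinner_commute: "jinner x y = jinner y (x::'a::euclidean_jordan_algebra)"
  by (simp add: jinner_def jprod_commute)

interpretation jinner: bounded_bilinear "jinner :: 'a::euclidean_jordan_algebra \<Rightarrow> 'a \<Rightarrow> real"
  unfolding bilinear_conv_bounded_bilinear[symmetric] bilinear_def jinner_def
  by (auto intro!: linearI simp: jprod_linear_simps jtr_linear_simps)

lemmas jinner_linear_simps =
  jinner.add_left jinner.add_right jinner.diff_left jinner.diff_right
  jinner.minus_left jinner.minus_right jinner.scaleR_left jinner.scaleR_right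

lemma jinner_self_spectral:
  fixes x :: "'a::euclidean_jordan_algebra"
  assumes "spectral_decomp x C ev"
  shows "jinner x x = (\<Sum>c\<in>C. ev c * ev c)"
proof -
  have C: "jordan_frame C" and x: "x = (\<Sum>c\<in>C. ev c *\<^sub>R c)"
    using assms by (auto simp: spectral_decomp_def)
  have "spectral_decomp (x \<circ>\<^sub>J x) C (\<lambda>c. ev c * ev c)"
    using C by (simp add: spectral_decomp_def x
        orthogonal_idempotents_prod_sum[OF jordan_frame_orthogonal_idempotents[OF C]])
  from jtr_spectral[OF this] show ?thesis by (simp add: jinner_def)
qed

lemma jinner_self_nonneg: "0 \<le> jinner x (x :: 'a::euclidean_jordan_algebra)"
proof -
  obtain C ev where "spectral_decomp x C ev" using spectral_decomp_exists by blast
  then show ?thesis by (simp add: jinner_self_spectral sum_nonneg)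
qed

lemma jinner_self_eq_0:
  fixes x :: "'a::euclidean_jordan_algebra"
  assumes "jinner x x = 0"
  shows "x = 0"
proof -
  obtain C ev where C: "spectral_decomp x C ev" using spectral_decomp_exists by blast
  then have "(\<Sum>c\<in>C. ev c * ev c) = 0" using assms jinner_self_spectral by metis
  then have "\<forall>c\<in>C. ev c = 0"
    using C by (subst (asm) sum_nonneg_eq_0_iff) (auto simp: spectral_decomp_def jordan_frame_def)
  then show ?thesis using C by (simp add: spectral_decomp_def)
qed

lemma jinner_quad_rep: "jinner (quad_rep a x) y = jinner x (quad_rep a (y::'a::euclidean_jordan_algebra))"
  by (simp add: quad_rep_def jL_def jinner_linear_simps jinner_assoc)

lemma linear_quad_rep: "linear (quad_rep (a::'a::euclidean_jordan_algebra))"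
  by (auto intro!: linearI simp: quad_rep_def jL_def jprod_linear_simps algebra_simps)

lemma jinner_frame_nonneg:
  fixes a b :: "'a::euclidean_jordan_algebra"
  assumes C: "jordan_frame C" "a \<in> C" and b: "idempotent b"
  shows "0 \<le> jinner a b"
proof -
  have fin: "finite C" using C by (simp add: jordan_frame_def)
  have "trace_vector \<circ>\<^sub>J a = (1 / inner a a) *\<^sub>R a"
    using trace_vector_prod_frame[OF C(1), of "\<lambda>c. if c = a then 1 else 0"] fin C(2)
    by (simp add: if_distrib[of "\<lambda>t. t *\<^sub>R _"] if_distrib[of "\<lambda>t. t / _"] cong: if_cong)
  then have "jinner a b = inner a b / inner a a"
    using inner_jprod_assoc[of a trace_vector b]
    by (simp add: jinner_def jtr_eq_inner jprod_commute[of a trace_vector])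
  moreover have "inner a b = inner (a \<circ>\<^sub>J b) b"
    using b inner_jprod_assoc[of b a b] by (simp add: idempotent_def jprod_commute[of b a])
  moreover have "idempotent a"
    using C by (auto simp: jordan_frame_def primitive_idempotent_def)
  ultimately show ?thesis using idempotent_inner_nonneg[of a b] by simp
qed

section \<open>Positive elements and their inverses\<close>

text \<open>
  Phrased through the multiplication operator rather than through eigenvalues, so that stability
  under small perturbations is immediate.  These elements form the interior of the cone of squares.
\<close>

definition jpositive :: "'a::euclidean_jordan_algebra \<Rightarrow> bool" where
  "jpositive w \<longleftrightarrow> (\<exists>m>0. \<forall>v. m * inner v v \<le> inner (w \<circ>\<^sub>J v) v)"

lemma inner_frame_combination:
  fixes C :: "'a::euclidean_jordan_algebra set"
  shows "inner ((\<Sum>c\<in>C. f c *\<^sub>R c) \<circ>\<^sub>J v) v = (\<Sum>c\<in>C. f c * inner (c \<circ>\<^sub>J v) v)"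
  by (simp add: jprod.sum_left inner_sum_left jprod_scaleR_left)

lemma jpositive_spectral_iff:
  fixes w :: "'a::euclidean_jordan_algebra"
  assumes w: "spectral_decomp w C ev"
  shows "jpositive w \<longleftrightarrow> (\<forall>c\<in>C. 0 < ev c)"
proof
  have C: "jordan_frame C" and wsum: "w = (\<Sum>c\<in>C. ev c *\<^sub>R c)"
    using w by (auto simp: spectral_decomp_def)
  note oi = jordan_frame_orthogonal_idempotents[OF C]
  have fin: "finite C" and idem: "\<And>c. c \<in> C \<Longrightarrow> idempotent c \<and> c \<noteq> 0"
    using oi by (auto simp: orthogonal_idempotents_def)
  {
    assume "jpositive w"
    then obtain m where m: "m > 0" "\<And>v. m * inner v v \<le> inner (w \<circ>\<^sub>J v) v"
      by (auto simp: jpositive_def)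
    show "\<forall>c\<in>C. 0 < ev c"
    proof
      fix c assume c: "c \<in> C"
      have "w \<circ>\<^sub>J c = (\<Sum>d\<in>C. if d = c then ev c *\<^sub>R c else 0)"
        unfolding wsum jprod.sum_left using oi c
        by (intro sum.cong) (auto simp: orthogonal_idempotents_def idempotent_def jprod_scaleR_left)
      then have "w \<circ>\<^sub>J c = ev c *\<^sub>R c" using fin c by simp
      then have "0 < ev c * inner c c"
        using m(2)[of c] m(1) idem[OF c] by (smt (verit) inner_gt_zero_iff inner_scaleR_left mult_pos_pos)
      then show "0 < ev c" using idem[OF c] by (metis inner_gt_zero_iff zero_less_mult_pos2)
    qed
  }
  assume pos: "\<forall>c\<in>C. 0 < ev c"
  define m where "m = Min (insert 1 (ev ` C))"
  have "m > 0" using pos fin by (auto simp: m_def)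
  moreover have "m * inner v v \<le> inner (w \<circ>\<^sub>J v) v" for v
  proof -
    have "m * inner v v = m * inner ((\<Sum>c\<in>C. 1 *\<^sub>R c) \<circ>\<^sub>J v) v"
      using C by (simp add: jordan_frame_def jone_left)
    also have "\<dots> = (\<Sum>c\<in>C. m * inner (c \<circ>\<^sub>J v) v)"
      unfolding inner_frame_combination by (simp add: sum_distrib_left)
    also have "\<dots> \<le> (\<Sum>c\<in>C. ev c * inner (c \<circ>\<^sub>J v) v)"
      using idem idempotent_inner_nonneg fin by (intro sum_mono mult_right_mono) (auto simp: m_def)
    finally show ?thesis unfolding wsum inner_frame_combination .
  qed
  ultimately show "jpositive w" by (auto simp: jpositive_def)
qed

lemma jpositive_norm_le:
  fixes w v :: "'a::euclidean_jordan_algebra"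
  assumes "\<And>v. m * inner v v \<le> inner (w \<circ>\<^sub>J v) v"
  shows "m * norm v \<le> norm (w \<circ>\<^sub>J v)"
proof (cases "v = 0")
  case False
  have "m * norm v * norm v \<le> norm (w \<circ>\<^sub>J v) * norm v"
    using assms[of v] norm_cauchy_schwarz[of "w \<circ>\<^sub>J v" v]
    by (simp add: dot_square_norm power2_eq_square mult.assoc)
  then show ?thesis using False by simp
qed (simp add: jprod.zero_right)

lemma jpositive_cancel:
  fixes w :: "'a::euclidean_jordan_algebra"
  assumes "jpositive w" "w \<circ>\<^sub>J x = w \<circ>\<^sub>J y"
  shows "x = y"
proof -
  obtain m where m: "m > 0" "\<And>v. m * inner v v \<le> inner (w \<circ>\<^sub>J v) v"
    using assms(1) by (auto simp: jpositive_def)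
  have "m * norm (x - y) \<le> 0"
    using jpositive_norm_le[of m w "x - y", OF m(2)] assms(2) by (simp add: jprod_linear_simps)
  then show ?thesis using m(1) by (simp add: mult_le_0_iff)
qed

definition jinv :: "'a::euclidean_jordan_algebra \<Rightarrow> 'a" where
  "jinv w = (THE y. w \<circ>\<^sub>J y = jone)"

lemma jinv_unique: "jpositive w \<Longrightarrow> w \<circ>\<^sub>J y = jone \<Longrightarrow> jinv w = y"
  unfolding jinv_def by (rule the_equality) (auto intro: jpositive_cancel)

lemma jinv_spectral:
  fixes w :: "'a::euclidean_jordan_algebra"
  assumes w: "spectral_decomp w C ev" and "jpositive w"
  shows "jinv w = (\<Sum>c\<in>C. (1 / ev c) *\<^sub>R c)"
proof (rule jinv_unique[OF assms(2)])
  have C: "jordan_frame C" and ws: "w = (\<Sum>c\<in>C. ev c *\<^sub>R c)"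
    using w by (auto simp: spectral_decomp_def)
  have "ev c \<noteq> 0" if "c \<in> C" for c using that assms jpositive_spectral_iff[OF w] by auto
  then have "w \<circ>\<^sub>J (\<Sum>c\<in>C. (1 / ev c) *\<^sub>R c) = (\<Sum>c\<in>C. 1 *\<^sub>R c)"
    unfolding ws orthogonal_idempotents_prod_sum[OF jordan_frame_orthogonal_idempotents[OF C]]
    by (intro sum.cong) auto
  then show "w \<circ>\<^sub>J (\<Sum>c\<in>C. (1 / ev c) *\<^sub>R c) = jone" using C by (simp add: jordan_frame_def)
qed

text \<open>
  Elements that are diagonal in one frame operator-commute, because orthogonal idempotents do.
\<close>

lemma frame_combinations_commute:
  fixes C :: "'a::euclidean_jordan_algebra set"
  assumes "orthogonal_idempotents C"
  shows "(\<Sum>c\<in>C. f c *\<^sub>R c) \<circ>\<^sub>J ((\<Sum>c\<in>C. g c *\<^sub>R c) \<circ>\<^sub>J v)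
       = (\<Sum>c\<in>C. g c *\<^sub>R c) \<circ>\<^sub>J ((\<Sum>c\<in>C. f c *\<^sub>R c) \<circ>\<^sub>J v)"
proof -
  have "c \<circ>\<^sub>J (d \<circ>\<^sub>J v) = d \<circ>\<^sub>J (c \<circ>\<^sub>J v)" if "c \<in> C" "d \<in> C" for c d
    using assms that orthogonal_idempotent_commute[of d c v]
    by (cases "c = d") (auto simp: orthogonal_idempotents_def)
  note comm = this
  have expand: "(\<Sum>c\<in>C. f c *\<^sub>R c) \<circ>\<^sub>J ((\<Sum>d\<in>C. g d *\<^sub>R d) \<circ>\<^sub>J v)
      = (\<Sum>c\<in>C. \<Sum>d\<in>C. (f c * g d) *\<^sub>R (c \<circ>\<^sub>J (d \<circ>\<^sub>J v)))" for f g
  proof -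
    have "c \<circ>\<^sub>J ((\<Sum>d\<in>C. g d *\<^sub>R d) \<circ>\<^sub>J v) = (\<Sum>d\<in>C. g d *\<^sub>R (c \<circ>\<^sub>J (d \<circ>\<^sub>J v)))" for c
      by (simp add: jprod.sum_left jprod.sum_right jprod_linear_simps)
    then show ?thesis
      by (subst jprod.sum_left) (simp add: jprod_scaleR_left scaleR_sum_right mult.commute)
  qed
  show ?thesis
    unfolding expand by (subst sum.swap) (simp add: comm mult.commute)
qed

lemma jinv_properties:
  fixes w :: "'a::euclidean_jordan_algebra"
  assumes "jpositive w"
  shows jprod_jinv: "w \<circ>\<^sub>J jinv w = jone"
    and jinv_commute: "w \<circ>\<^sub>J (jinv w \<circ>\<^sub>J v) = jinv w \<circ>\<^sub>J (w \<circ>\<^sub>J v)"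
    and jinv_square_commute: "w \<circ>\<^sub>J ((jinv w \<circ>\<^sub>J jinv w) \<circ>\<^sub>J v) = (jinv w \<circ>\<^sub>J jinv w) \<circ>\<^sub>J (w \<circ>\<^sub>J v)"
proof -
  obtain C ev where w: "spectral_decomp w C ev" using spectral_decomp_exists by blast
  then have C: "orthogonal_idempotents C" and ws: "w = (\<Sum>c\<in>C. ev c *\<^sub>R c)"
    using jordan_frame_orthogonal_idempotents by (auto simp: spectral_decomp_def)
  note inv = jinv_spectral[OF w assms]
  have "\<And>c. c \<in> C \<Longrightarrow> ev c \<noteq> 0" using assms jpositive_spectral_iff[OF w] by force
  then show "w \<circ>\<^sub>J jinv w = jone"
    using w unfolding inv unfolding ws orthogonal_idempotents_prod_sum[OF C]
    by (simp add: spectral_decomp_def jordan_frame_def)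
  show "w \<circ>\<^sub>J (jinv w \<circ>\<^sub>J v) = jinv w \<circ>\<^sub>J (w \<circ>\<^sub>J v)"
    unfolding inv unfolding ws by (rule frame_combinations_commute[OF C])
  show "w \<circ>\<^sub>J ((jinv w \<circ>\<^sub>J jinv w) \<circ>\<^sub>J v) = (jinv w \<circ>\<^sub>J jinv w) \<circ>\<^sub>J (w \<circ>\<^sub>J v)"
    unfolding inv unfolding ws orthogonal_idempotents_prod_sum[OF C] by (rule frame_combinations_commute[OF C])
qed

text \<open>
  On the joint Peirce space of two frame members on which \<open>w\<close> has eigenvalues \<open>a\<close> and \<open>b\<close>, the
  operators \<open>P(w)\<close>, \<open>L(y)\<close> and \<open>L(w)\<close> act as \<open>a b\<close>, \<open>(1/a + 1/b) / 2\<close> and \<open>(a + b) / 2\<close>.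
\<close>

lemma quad_rep_jprod_inverse:
  fixes w y v :: "'a::euclidean_jordan_algebra"
  assumes e: "w \<circ>\<^sub>J y = jone" and comm: "\<And>v. w \<circ>\<^sub>J (y \<circ>\<^sub>J v) = y \<circ>\<^sub>J (w \<circ>\<^sub>J v)"
  shows "quad_rep w (y \<circ>\<^sub>J v) = w \<circ>\<^sub>J v"
proof -
  have "(w \<circ>\<^sub>J w) \<circ>\<^sub>J y = w"
    using comm[of w] by (simp add: jprod_commute[of "w \<circ>\<^sub>J w" y] jprod_commute[of y w] e jone_right)
  then have "w \<circ>\<^sub>J v = 2 *\<^sub>R (w \<circ>\<^sub>J v) + (w \<circ>\<^sub>J w) \<circ>\<^sub>J (y \<circ>\<^sub>J v) - 2 *\<^sub>R (w \<circ>\<^sub>J (w \<circ>\<^sub>J (y \<circ>\<^sub>J v)))"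
    using jprod_triple[of w w y v] by (simp add: e jone_left comm[symmetric] scaleR_2 algebra_simps)
  then show ?thesis by (simp add: quad_rep_def jL_def algebra_simps scaleR_2)
qed

lemma jprod_surj:
  fixes w :: "'a::euclidean_jordan_algebra"
  assumes "jpositive w"
  shows "\<exists>u. v = w \<circ>\<^sub>J u"
proof -
  have "linear (\<lambda>u. w \<circ>\<^sub>J u)" by (simp add: jprod.bounded_linear_right bounded_linear.linear)
  moreover have "inj (\<lambda>u. w \<circ>\<^sub>J u)" using jpositive_cancel[OF assms] by (auto intro: injI)
  ultimately have "surj (\<lambda>u. w \<circ>\<^sub>J u)" by (rule linear_inj_imp_surj)
  then show ?thesis by (auto simp: surj_def)
qed

text \<open>
  From \<open>P(w) L(y) = L(w)\<close>, and the same with \<open>w\<close> and its inverse \<open>y\<close> exchanged,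
  \<open>P(w) P(y) L(w) = P(w) L(y) = L(w)\<close>; the factor \<open>L(w)\<close> cancels because it is surjective.
\<close>

lemma
  fixes w v :: "'a::euclidean_jordan_algebra"
  assumes w: "jpositive w"
  shows quad_rep_quad_rep_jinv: "quad_rep w (quad_rep (jinv w) v) = v"
    and quad_rep_jinv_quad_rep: "quad_rep (jinv w) (quad_rep w v) = v"
    and quad_rep_jinv_jprod: "w \<circ>\<^sub>J quad_rep (jinv w) v = jinv w \<circ>\<^sub>J v"
    and quad_rep_jinv_self: "quad_rep (jinv w) w = jinv w"
    and quad_rep_self_jinv: "quad_rep w (jinv w) = w"
proof -
  let ?y = "jinv w"
  have 1: "quad_rep w (?y \<circ>\<^sub>J v) = w \<circ>\<^sub>J v" for v
    by (rule quad_rep_jprod_inverse) (simp_all add: jinv_properties[OF w])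
  have 2: "quad_rep ?y (w \<circ>\<^sub>J v) = ?y \<circ>\<^sub>J v" for v
    by (rule quad_rep_jprod_inverse) (simp_all add: jprod_commute[of ?y w] jinv_properties[OF w])
  show a: "quad_rep w (quad_rep ?y v) = v" for v using jprod_surj[OF w, of v] 1 2 by auto
  show "quad_rep ?y (quad_rep w v) = v"
  proof -
    have "inj (quad_rep ?y)" by (metis a injI)
    then show ?thesis using a[of "quad_rep w v"] linear_inj_imp_surj[OF linear_quad_rep]
      by (metis a surjD)
  qed
  show "w \<circ>\<^sub>J quad_rep ?y v = ?y \<circ>\<^sub>J v"
    using 2[of v] unfolding quad_rep_def jL_def
    by (simp add: jprod_linear_simps jinv_properties[OF w])
  show "quad_rep ?y w = ?y" using 2[of jone] by (simp add: jone_right)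
  show "quad_rep w ?y = w" using 1[of jone] by (simp add: jone_right)
qed

section \<open>Differentiating the inverse\<close>

lemma jpositive_neighbourhood:
  fixes w :: "'a::euclidean_jordan_algebra"
  assumes "jpositive w"
  shows "\<exists>m>0. \<forall>\<^sub>F w' in nhds w. \<forall>v. m * inner v v \<le> inner (w' \<circ>\<^sub>J v) v"
proof -
  obtain m where m: "m > 0" "\<And>v. m * inner v v \<le> inner (w \<circ>\<^sub>J v) v"
    using assms by (auto simp: jpositive_def)
  obtain K where K: "K > 0" "\<And>a b :: 'a. norm (a \<circ>\<^sub>J b) \<le> norm a * norm b * K"
    using jprod.pos_bounded by blast
  have "(m / 2) * inner v v \<le> inner (w' \<circ>\<^sub>J v) v" if "dist w' w < m / (2 * K)" for w' v
  proof -
    have "\<bar>inner ((w' - w) \<circ>\<^sub>J v) v\<bar> \<le> (norm (w' - w) * norm v * K) * norm v"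
      using Cauchy_Schwarz_ineq2[of "(w' - w) \<circ>\<^sub>J v" v] K(2)[of "w' - w" v]
      by (meson mult_right_mono norm_ge_zero order_trans)
    also have "\<dots> = (norm (w' - w) * K) * inner v v" by (simp add: dot_square_norm power2_eq_square)
    also have "\<dots> \<le> (m / 2) * inner v v"
      using that K(1) by (intro mult_right_mono) (auto simp: dist_norm field_simps)
    finally have "- inner ((w' - w) \<circ>\<^sub>J v) v \<le> (m / 2) * inner v v" by (rule abs_le_D2)
    then show ?thesis using m(2)[of v] by (simp add: jprod_linear_simps inner_diff_left)
  qed
  then have "\<forall>\<^sub>F w' in nhds w. \<forall>v. (m / 2) * inner v v \<le> inner (w' \<circ>\<^sub>J v) v"
    using m(1) K(1) by (intro eventually_nhds_metric[THEN iffD2] exI[of _ "m / (2 * K)"]) auto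
  then show ?thesis using m(1) by (intro exI[of _ "m / 2"]) auto
qed

lemma eventually_jpositive:
  "jpositive w \<Longrightarrow> \<forall>\<^sub>F w' in nhds w. jpositive (w' :: 'a::euclidean_jordan_algebra)"
  using jpositive_neighbourhood[of w] unfolding jpositive_def by (auto elim: eventually_mono)

text \<open>
  The lower bound shared by all elements near \<open>w\<close> bounds their inverses, and
  \<open>w (y' - y) = - (w' - w) y'\<close> turns this into a Lipschitz estimate at \<open>w\<close>.
\<close>

lemma jinv_tendsto:
  fixes w :: "'a::euclidean_jordan_algebra"
  assumes w: "jpositive w"
  shows "(jinv \<longlongrightarrow> jinv w) (nhds w)"
proof -
  obtain m where m: "m > 0"
    and ev: "\<forall>\<^sub>F w' in nhds w. \<forall>v. m * inner v v \<le> inner (w' \<circ>\<^sub>J v) v"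
    using jpositive_neighbourhood[OF w] by blast
  have mw: "\<And>v. m * inner v v \<le> inner (w \<circ>\<^sub>J v) v" using eventually_nhds_x_imp_x[OF ev] by blast
  obtain K where K: "K > 0" "\<And>a b :: 'a. norm (a \<circ>\<^sub>J b) \<le> norm a * norm b * K"
    using jprod.pos_bounded by blast
  have "\<forall>\<^sub>F w' in nhds w. norm (jinv w' - jinv w) \<le> norm (w' - w) * (norm (jone::'a) * K / (m * m))"
    using ev
  proof eventually_elim
    case (elim w')
    then have w': "jpositive w'" using m by (auto simp: jpositive_def)
    have "m * norm (jinv w') \<le> norm (jone::'a)"
      using jpositive_norm_le[of m w' "jinv w'"] elim jprod_jinv[OF w'] by simp
    then have b: "norm (jinv w') \<le> norm (jone::'a) / m" using m by (simp add: field_simps)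
    have "w \<circ>\<^sub>J (jinv w' - jinv w) = - ((w' - w) \<circ>\<^sub>J jinv w')"
      using jprod_jinv[OF w'] jprod_jinv[OF w] by (simp add: jprod_linear_simps)
    then have "m * norm (jinv w' - jinv w) \<le> norm ((w' - w) \<circ>\<^sub>J jinv w')"
      using jpositive_norm_le[of m w "jinv w' - jinv w", OF mw] by simp
    also have "\<dots> \<le> norm (w' - w) * norm (jinv w') * K" by (rule K(2))
    also have "\<dots> \<le> norm (w' - w) * (norm (jone::'a) / m) * K"
      using b K(1) by (intro mult_right_mono mult_left_mono) auto
    finally show ?case using m by (simp add: field_simps)
  qed
  moreover have "((\<lambda>w'. norm (w' - w) * (norm (jone::'a) * K / (m * m))) \<longlongrightarrow> 0) (nhds w)"
    by (intro tendsto_mult_left_zero tendsto_norm_zero LIM_zero tendsto_ident_at filterlim_ident)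
  ultimately have "((\<lambda>w'. jinv w' - jinv w) \<longlongrightarrow> 0) (nhds w)"
    by (rule Lim_null_comparison)
  then show ?thesis by (rule LIM_zero_cancel)
qed

lemma line_tendsto:
  fixes w q :: "'a::real_normed_vector"
  shows "filterlim (\<lambda>t. w + t *\<^sub>R q) (nhds w) (nhds 0)"
  by (auto intro!: tendsto_eq_intros filterlim_ident)

text \<open>
  Subtracting \<open>w y = e\<close> from the same equation at \<open>w + t q\<close> leaves a linear equation for the
  difference quotient; the limit is identified by multiplying with \<open>w\<close>.
\<close>

lemma jinv_has_vector_derivative:
  fixes w q :: "'a::euclidean_jordan_algebra"
  assumes w: "jpositive w"
  shows "((\<lambda>t. jinv (w + t *\<^sub>R q)) has_vector_derivative - quad_rep (jinv w) q) (at 0)"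
proof -
  define y where "y = (\<lambda>t. jinv (w + t *\<^sub>R q))"
  define D where "D = - quad_rep (jinv w) q"
  obtain m where m: "m > 0" "\<And>v. m * inner v v \<le> inner (w \<circ>\<^sub>J v) v"
    using w by (auto simp: jpositive_def)
  have y0: "y 0 = jinv w" by (simp add: y_def)
  have pos: "\<forall>\<^sub>F t in at 0. jpositive (w + t *\<^sub>R q)"
    using eventually_compose_filterlim[OF eventually_jpositive[OF w] line_tendsto]
    by (simp add: eventually_nhds_conv_at)
  have lim: "(y \<longlongrightarrow> y 0) (nhds 0)"
    unfolding y_def using filterlim_compose[OF jinv_tendsto[OF w] line_tendsto] by simp
  have "\<forall>\<^sub>F t in at 0. norm (norm (y (0 + t) - y 0 - t *\<^sub>R D) / norm t) \<le> norm (q \<circ>\<^sub>J (y t - y 0)) / m"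
    using pos
  proof eventually_elim
    case (elim t)
    have "(w + t *\<^sub>R q) \<circ>\<^sub>J y t = jone" "w \<circ>\<^sub>J y 0 = jone"
      using elim w by (auto simp: y_def intro: jprod_jinv)
    then have "w \<circ>\<^sub>J y t = jone - t *\<^sub>R (q \<circ>\<^sub>J y t)" by (simp add: jprod_linear_simps algebra_simps)
    moreover have "w \<circ>\<^sub>J D = - (q \<circ>\<^sub>J y 0)"
      unfolding D_def y0 by (simp add: jprod_linear_simps quad_rep_jinv_jprod[OF w] jprod_commute)
    ultimately have "w \<circ>\<^sub>J (y t - y 0 - t *\<^sub>R D) = - t *\<^sub>R (q \<circ>\<^sub>J (y t - y 0))"
      using \<open>w \<circ>\<^sub>J y 0 = jone\<close> by (simp add: jprod_linear_simps algebra_simps)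
    then have "m * norm (y t - y 0 - t *\<^sub>R D) \<le> \<bar>t\<bar> * norm (q \<circ>\<^sub>J (y t - y 0))"
      using jpositive_norm_le[of m w "y t - y 0 - t *\<^sub>R D", OF m(2)] by simp
    then have "norm (y t - y 0 - t *\<^sub>R D) \<le> \<bar>t\<bar> * (norm (q \<circ>\<^sub>J (y t - y 0)) / m)"
      using m(1) by (simp add: field_simps)
    then show ?case
      using m(1) by (cases "t = 0") (auto simp: divide_le_eq mult.commute)
  qed
  moreover have "((\<lambda>t. norm (q \<circ>\<^sub>J (y t - y 0)) / m) \<longlongrightarrow> 0) (at 0)"
  proof -
    have "((\<lambda>t. norm (q \<circ>\<^sub>J (y t - y 0)) / m) \<longlongrightarrow> norm (q \<circ>\<^sub>J (y 0 - y 0)) / m) (at 0)"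
      using tendsto_mono[OF at_within_le_nhds lim]
      by (intro tendsto_intros jprod.tendsto) (use m in auto)
    then show ?thesis by (simp add: jprod.zero_right)
  qed
  ultimately have "((\<lambda>t. norm (y (0 + t) - y 0 - t *\<^sub>R D) / norm t) \<longlongrightarrow> 0) (at 0)"
    by (rule Lim_null_comparison)
  then show ?thesis
    unfolding has_vector_derivative_def has_derivative_at y_def[symmetric] D_def[symmetric]
    by (simp add: bounded_linear_scaleR_left)
qed

section \<open>The logarithm of the determinant\<close>

lemma jinner_frame_sums:
  fixes D :: "'a::euclidean_jordan_algebra set"
  assumes "jordan_frame D" "primitive_idempotent c"
  shows "(\<Sum>d\<in>D. jinner c d) = 1"
proof -
  have "(\<Sum>d\<in>D. jinner c d) = jinner c jone"
    using assms by (simp add: jinner.sum_right[symmetric] jordan_frame_def)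
  then show ?thesis
    using inner_trace_vector_primitive[OF assms(2)] by (simp add: jinner_def jone_right jtr_eq_inner)
qed

text \<open>
  The numbers \<open>tr (c \<circ> d)\<close>, for \<open>c\<close> and \<open>d\<close> in two frames, form a doubly stochastic matrix.
  Averaging the scalar inequality \<open>ln s \<le> s - 1\<close> at the ratios of eigenvalues with these weights
  gives the gradient inequality for the concave function \<open>ln det\<close>.
\<close>

lemma sum_ln_eigenvalues_le:
  fixes x y :: "'a::euclidean_jordan_algebra"
  assumes x: "spectral_decomp x C a" "jpositive x" and y: "spectral_decomp y D b" "jpositive y"
  shows "(\<Sum>d\<in>D. ln (b d)) - (\<Sum>c\<in>C. ln (a c)) \<le> jinner (jinv x) y - real (jrank TYPE('a))"
proof -
  have fC: "jordan_frame C" and fD: "jordan_frame D" using x y by (auto simp: spectral_decomp_def)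
  have pC: "primitive_idempotent c" "a c > 0" if "c \<in> C" for c
    using that fC x jpositive_spectral_iff[OF x(1)] by (auto simp: jordan_frame_def)
  have pD: "primitive_idempotent d" "b d > 0" if "d \<in> D" for d
    using that fD y jpositive_spectral_iff[OF y(1)] by (auto simp: jordan_frame_def)
  have rows: "(\<Sum>d\<in>D. jinner c d) = 1" if "c \<in> C" for c
    using jinner_frame_sums[OF fD] pC that by blast
  have cols: "(\<Sum>c\<in>C. jinner c d) = 1" if "d \<in> D" for d
    using jinner_frame_sums[OF fC] pD that by (simp add: jinner_commute[of _ d])
  have "(\<Sum>c\<in>C. \<Sum>d\<in>D. jinner c d * (ln (b d) - ln (a c)))
      \<le> (\<Sum>c\<in>C. \<Sum>d\<in>D. jinner c d * (b d / a c - 1))"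
  proof (intro sum_mono mult_left_mono)
    fix c d assume cd: "c \<in> C" "d \<in> D"
    show "ln (b d) - ln (a c) \<le> b d / a c - 1"
      using ln_le_minus_one[of "b d / a c"] pC[OF cd(1)] pD[OF cd(2)] by (simp add: ln_div)
    show "0 \<le> jinner c d"
      using jinner_frame_nonneg[OF fC cd(1)] pD[OF cd(2)] by (simp add: primitive_idempotent_def)
  qed
  moreover have "(\<Sum>c\<in>C. \<Sum>d\<in>D. jinner c d * (ln (b d) - ln (a c)))
      = (\<Sum>d\<in>D. ln (b d)) - (\<Sum>c\<in>C. ln (a c))"
  proof -
    have "(\<Sum>c\<in>C. \<Sum>d\<in>D. jinner c d * ln (b d)) = (\<Sum>d\<in>D. (\<Sum>c\<in>C. jinner c d) * ln (b d))"
      by (subst sum.swap) (simp add: sum_distrib_right)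
    moreover have "(\<Sum>c\<in>C. \<Sum>d\<in>D. jinner c d * ln (a c)) = (\<Sum>c\<in>C. (\<Sum>d\<in>D. jinner c d) * ln (a c))"
      by (simp add: sum_distrib_right)
    ultimately show ?thesis by (simp add: right_diff_distrib sum_subtractf rows cols)
  qed
  moreover have "(\<Sum>c\<in>C. \<Sum>d\<in>D. jinner c d * (b d / a c - 1))
      = jinner (jinv x) y - real (jrank TYPE('a))"
  proof -
    have ys: "y = (\<Sum>d\<in>D. b d *\<^sub>R d)" using y by (simp add: spectral_decomp_def)
    have "jinner (jinv x) y = (\<Sum>c\<in>C. \<Sum>d\<in>D. jinner c d * (b d / a c))"
      unfolding jinv_spectral[OF x] ys
      by (subst jinner.sum_left)
        (simp add: jinner.sum_right jinner_linear_simps sum_distrib_left sum_divide_distrib mult.commute)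
    moreover have "(\<Sum>c\<in>C. \<Sum>d\<in>D. jinner c d) = real (jrank TYPE('a))"
      by (simp add: rows card_jordan_frame[OF fC])
    ultimately show ?thesis by (simp add: right_diff_distrib sum_subtractf)
  qed
  ultimately show ?thesis by simp
qed

lemma jinner_jinv_self:
  fixes w :: "'a::euclidean_jordan_algebra"
  shows "jpositive w \<Longrightarrow> jinner (jinv w) w = real (jrank TYPE('a))"
  by (simp add: jinner_def jprod_commute[of "jinv w"] jprod_jinv jtr_jone)

text \<open>The inequality also shows that the product of the eigenvalues depends on \<open>w\<close> only.\<close>

lemma jdet_spectral:
  fixes w :: "'a::euclidean_jordan_algebra"
  assumes w: "spectral_decomp w C ev" "jpositive w"
  shows "jdet w = (\<Prod>c\<in>C. ev c)" "0 < jdet w" "ln (jdet w) = (\<Sum>c\<in>C. ln (ev c))"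
proof -
  have pos: "0 < (\<Prod>c\<in>D. f c)" "ln (\<Prod>c\<in>D. f c) = (\<Sum>c\<in>D. ln (f c))"
    if "spectral_decomp w D f" for D f
  proof -
    have "\<And>c. c \<in> D \<Longrightarrow> 0 < f c" "finite D"
      using that jpositive_spectral_iff[OF that] w(2) by (auto simp: spectral_decomp_def jordan_frame_def)
    then show "0 < (\<Prod>c\<in>D. f c)" "ln (\<Prod>c\<in>D. f c) = (\<Sum>c\<in>D. ln (f c))"
      by (force intro!: prod_pos ln_prod)+
  qed
  have "(\<Prod>c\<in>D. f c) = (\<Prod>c\<in>C. ev c)" if D: "spectral_decomp w D f" for D f
  proof -
    have "(\<Sum>c\<in>D. ln (f c)) = (\<Sum>c\<in>C. ln (ev c))"
      using sum_ln_eigenvalues_le[OF D w(2) w] sum_ln_eigenvalues_le[OF w D w(2)]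
      by (simp add: jinner_jinv_self[OF w(2)])
    then show ?thesis using pos[OF D] pos[OF w(1)] by (metis exp_ln)
  qed
  then show eq: "jdet w = (\<Prod>c\<in>C. ev c)"
    unfolding jdet_def using w(1) by (intro the_equality) blast+
  show "0 < jdet w" "ln (jdet w) = (\<Sum>c\<in>C. ln (ev c))" using pos[OF w(1)] by (simp_all add: eq)
qed

lemma jdet_pos: "jpositive w \<Longrightarrow> 0 < jdet (w::'a::euclidean_jordan_algebra)"
  using spectral_decomp_exists[of w] jdet_spectral(2) by blast

lemma ln_jdet_gradient_inequality:
  fixes x y :: "'a::euclidean_jordan_algebra"
  assumes "jpositive x" "jpositive y"
  shows "ln (jdet y) - ln (jdet x) \<le> jinner (jinv x) (y - x)"
proof -
  obtain C a D b where "spectral_decomp x C a" "spectral_decomp y D b"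
    using spectral_decomp_exists by blast
  then show ?thesis
    using sum_ln_eigenvalues_le[of x C a y D b] assms
    by (simp add: jdet_spectral(3) jinner_linear_simps jinner_jinv_self)
qed

text \<open>
  The gradient inequality, used from both end points, traps the difference quotient between
  the values of \<open>t \<mapsto> ((w + t r)\<^sup>-\<^sup>1, r)\<close> at those points, and this function is continuous.
\<close>

lemma ln_jdet_has_derivative:
  fixes w r :: "'a::euclidean_jordan_algebra"
  assumes w: "jpositive w"
  shows "((\<lambda>t. ln (jdet (w + t *\<^sub>R r))) has_real_derivative jinner (jinv w) r) (at 0)"
proof -
  define f where "f = (\<lambda>t. ln (jdet (w + t *\<^sub>R r)))"
  define g where "g = (\<lambda>t. jinner (jinv (w + t *\<^sub>R r)) r)"
  have pos: "\<forall>\<^sub>F t in at 0. jpositive (w + t *\<^sub>R r)"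
    using eventually_compose_filterlim[OF eventually_jpositive[OF w] line_tendsto]
    by (simp add: eventually_nhds_conv_at)
  have "\<forall>\<^sub>F t in at 0. norm ((f (0 + t) - f 0) / t - g 0) \<le> \<bar>g t - g 0\<bar>"
    using pos eventually_neq_at_within[of 0]
  proof eventually_elim
    case (elim t)
    have "f t - f 0 \<le> t * g 0"
      using ln_jdet_gradient_inequality[OF w elim(1)] by (simp add: f_def g_def jinner_linear_simps)
    moreover have "t * g t \<le> f t - f 0"
      using ln_jdet_gradient_inequality[OF elim(1) w] by (simp add: f_def g_def jinner_linear_simps)
    ultimately have "\<bar>f t - f 0 - t * g 0\<bar> \<le> \<bar>t * (g t - g 0)\<bar>" by (simp add: right_diff_distrib)
    moreover have "(f t - f 0) / t - g 0 = (f t - f 0 - t * g 0) / t"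
      using elim by (simp add: field_simps)
    ultimately show ?case using elim(2) by (simp add: abs_mult divide_le_eq mult.commute)
  qed
  moreover have "((\<lambda>t. \<bar>g t - g 0\<bar>) \<longlongrightarrow> 0) (at 0)"
  proof -
    have "((\<lambda>t. jinv (w + t *\<^sub>R r)) \<longlongrightarrow> jinv (w + 0 *\<^sub>R r)) (at 0)"
      using filterlim_compose[OF jinv_tendsto[OF w] tendsto_mono[OF at_within_le_nhds line_tendsto]]
      by simp
    then have "((\<lambda>t. \<bar>g t - g 0\<bar>) \<longlongrightarrow> \<bar>g 0 - g 0\<bar>) (at 0)"
      unfolding g_def by (intro tendsto_intros jinner.tendsto)
    then show ?thesis by simp
  qed
  ultimately have "((\<lambda>t. (f (0 + t) - f 0) / t - g 0) \<longlongrightarrow> 0) (at 0)"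
    by (rule Lim_null_comparison)
  then have "((\<lambda>t. (f (0 + t) - f 0) / t) \<longlongrightarrow> g 0) (at 0)" by (rule LIM_zero_cancel)
  then show ?thesis by (simp add: DERIV_def f_def g_def)
qed

section \<open>Square roots and the interior of the cone\<close>

text \<open>
  Two positive roots \<open>s\<close> and \<open>t\<close> satisfy \<open>(s + t) \<circ> (s - t) = 0\<close>, and \<open>s + t\<close> is cancellable;
  hence the root built from eigenvalues is independent of the frame.
\<close>

lemma jsqrt_square:
  fixes w :: "'a::euclidean_jordan_algebra"
  assumes w: "jpositive w"
  shows "jsqrt w \<circ>\<^sub>J jsqrt w = w"
proof -
  define root where "root = (\<lambda>C ev. \<Sum>c\<in>C. sqrt (ev c) *\<^sub>R c :: 'a)"
  have root: "root C ev \<circ>\<^sub>J root C ev = w" "jpositive (root C ev)" if d: "spectral_decomp w C ev" for C ev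
  proof -
    have C: "jordan_frame C" and ws: "w = (\<Sum>c\<in>C. ev c *\<^sub>R c)" using d by (auto simp: spectral_decomp_def)
    have pos: "\<And>c. c \<in> C \<Longrightarrow> 0 < ev c" using jpositive_spectral_iff[OF d] w by blast
    show "root C ev \<circ>\<^sub>J root C ev = w"
      unfolding root_def orthogonal_idempotents_prod_sum[OF jordan_frame_orthogonal_idempotents[OF C]] ws
      by (intro sum.cong) (auto simp: abs_of_pos pos)
    have "spectral_decomp (root C ev) C (\<lambda>c. sqrt (ev c))"
      using C by (simp add: spectral_decomp_def root_def)
    then show "jpositive (root C ev)" using jpositive_spectral_iff pos by fastforce
  qed
  have unique: "s = t" if st: "jpositive s" "jpositive t" "s \<circ>\<^sub>J s = t \<circ>\<^sub>J t" for s t :: 'a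
  proof (rule jpositive_cancel[of "s + t"])
    obtain m n where "m > 0" "\<And>v. m * inner v v \<le> inner (s \<circ>\<^sub>J v) v" "n > 0"
      "\<And>v. n * inner v v \<le> inner (t \<circ>\<^sub>J v) v" using st by (auto simp: jpositive_def)
    then have "\<forall>v. (m + n) * inner v v \<le> inner ((s + t) \<circ>\<^sub>J v) v" "m + n > 0"
      by (auto simp: jprod_linear_simps inner_add_left distrib_right add_mono)
    then show "jpositive (s + t)" unfolding jpositive_def by blast
    show "(s + t) \<circ>\<^sub>J s = (s + t) \<circ>\<^sub>J t"
      using st(3) by (simp add: jprod_linear_simps jprod_commute[of t s])
  qed
  obtain C ev where d: "spectral_decomp w C ev" using spectral_decomp_exists by blast
  have "jsqrt w = (THE s. \<exists>C ev. spectral_decomp w C ev \<and> s = root C ev)"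
    by (simp add: jsqrt_def root_def)
  also have "\<dots> = root C ev"
  proof (rule the_equality)
    show "\<exists>C' ev'. spectral_decomp w C' ev' \<and> root C ev = root C' ev'" using d by blast
    show "s = root C ev" if "\<exists>C ev. spectral_decomp w C ev \<and> s = root C ev" for s
      using that root d unique by metis
  qed
  finally show ?thesis using root(1)[OF d] by simp
qed

lemma square_inner_nonneg:
  fixes x v :: "'a::euclidean_jordan_algebra"
  shows "0 \<le> inner ((x \<circ>\<^sub>J x) \<circ>\<^sub>J v) v"
proof -
  obtain C ev where C: "orthogonal_idempotents C" and x: "x = (\<Sum>c\<in>C. ev c *\<^sub>R c)"
    using spectral_decomp_exists[of x] jordan_frame_orthogonal_idempotents
    by (auto simp: spectral_decomp_def)
  show ?thesis
    unfolding x orthogonal_idempotents_prod_sum[OF C] inner_frame_combination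
    using C
    by (intro sum_nonneg mult_nonneg_nonneg[OF zero_le_square] idempotent_inner_nonneg)
      (auto simp: orthogonal_idempotents_def)
qed

text \<open>
  Moving the first coordinate up stays in the set, which makes the bound on \<open>u\<close> strict; moving
  the second against the identity does too, which pushes \<open>w\<close> off the boundary of the cone.
\<close>

lemma interior_K_rtdet:
  fixes w :: "'a::euclidean_jordan_algebra"
  assumes "(u, w) \<in> interior K_rtdet"
  shows "jpositive w" "u < rtdet w"
proof -
  obtain e where e: "e > 0" "ball (u, w) e \<subseteq> K_rtdet" using assms by (auto simp: mem_interior)
  have "dist (u, w) (u + e / 2, w) < e" using e(1) by (simp add: dist_Pair_Pair dist_norm)
  then have "(u + e / 2, w) \<in> K_rtdet" using e(2) by (auto simp: subset_iff)
  then show "u < rtdet w" using e(1) by (auto simp: K_rtdet_def)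
  define h where "h = e / (2 * (norm (jone::'a) + 1))"
  have n: "norm (jone::'a) + 1 > 0" using norm_ge_zero[of "jone::'a"] by linarith
  then have h: "h > 0" using e(1) by (simp add: h_def)
  have "h * norm (jone::'a) \<le> h * (norm (jone::'a) + 1)" using h by simp
  also have "\<dots> = e / 2" using n by (simp add: h_def field_simps)
  finally have "dist (u, w) (u, w - h *\<^sub>R jone) < e"
    using e(1) h by (simp add: dist_Pair_Pair dist_norm)
  then have "(u, w - h *\<^sub>R jone) \<in> K_rtdet" using e(2) by (auto simp: subset_iff)
  then obtain x where x: "w - h *\<^sub>R jone = x \<circ>\<^sub>J x" by (auto simp: K_rtdet_def cone_squares_def)
  have "h * inner v v \<le> inner (w \<circ>\<^sub>J v) v" for v
    using square_inner_nonneg[of x v]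
    by (simp add: x[symmetric] jprod_linear_simps inner_diff_left jone_left)
  then show "jpositive w" using h by (auto simp: jpositive_def)
qed

lemma rtdet_eq_exp:
  fixes w :: "'a::euclidean_jordan_algebra"
  assumes "jpositive w"
  shows "rtdet w = exp (ln (jdet w) / real (jrank TYPE('a)))"
  using jdet_pos[OF assms] by (simp add: rtdet_def powr_def)

section \<open>Derivatives of the barrier\<close>

lemma rtdet_has_derivative:
  fixes w r :: "'a::euclidean_jordan_algebra"
  assumes w: "jpositive w"
  shows "((\<lambda>t. rtdet (w + t *\<^sub>R r)) has_real_derivative
      rtdet w * jinner (jinv w) r / real (jrank TYPE('a))) (at 0)"
proof -
  let ?d = "real (jrank TYPE('a))"
  have "\<forall>\<^sub>F t in nhds 0. rtdet (w + t *\<^sub>R r) = exp (ln (jdet (w + t *\<^sub>R r)) / ?d)"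
    using eventually_compose_filterlim[OF eventually_jpositive[OF w] line_tendsto]
    by eventually_elim (rule rtdet_eq_exp)
  moreover have "((\<lambda>t. exp (ln (jdet (w + t *\<^sub>R r)) / ?d)) has_real_derivative
      rtdet w * jinner (jinv w) r / ?d) (at 0)"
    using DERIV_fun_exp[OF DERIV_cdivide[OF ln_jdet_has_derivative[OF w, of r], of ?d]]
    by (simp add: rtdet_eq_exp[OF w])
  ultimately show ?thesis by (subst DERIV_cong_ev[OF refl _ refl])
qed

lemma jinner_jinv_has_derivative:
  fixes w q r :: "'a::euclidean_jordan_algebra"
  assumes w: "jpositive w"
  shows "((\<lambda>t. jinner (jinv (w + t *\<^sub>R q)) r) has_real_derivative
      - jinner (quad_rep (jinv w) q) r) (at 0)"
  using bounded_linear.has_vector_derivative[OF jinner.bounded_linear_left jinv_has_vector_derivative[OF w]]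
  by (simp add: has_real_derivative_iff_has_vector_derivative jinner_linear_simps)

definition Gamma_slope :: "real \<times> 'a::euclidean_jordan_algebra \<Rightarrow> real \<times> 'a \<Rightarrow> real" where
  "Gamma_slope = (\<lambda>(p, r) (u, w).
     - (rtdet w * jinner (jinv w) r / real (jrank TYPE('a)) - p) / (rtdet w - u) - jinner (jinv w) r)"

lemma Gamma_rtdet_has_derivative:
  fixes w r :: "'a::euclidean_jordan_algebra"
  assumes w: "jpositive w" and u: "u < rtdet w"
  shows "((\<lambda>t. Gamma_rtdet ((u, w) + t *\<^sub>R (p, r))) has_real_derivative
      Gamma_slope (p, r) (u, w)) (at 0)"
proof -
  define R F where "R = (\<lambda>t. rtdet (w + t *\<^sub>R r))" and "F = (\<lambda>t. ln (jdet (w + t *\<^sub>R r)))"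
  have R: "(R has_real_derivative R 0 * jinner (jinv w) r / real (jrank TYPE('a))) (at 0)"
    and F: "(F has_real_derivative jinner (jinv w) r) (at 0)"
    using rtdet_has_derivative[OF w] ln_jdet_has_derivative[OF w] by (simp_all add: R_def F_def)
  have R0: "R 0 = rtdet w" by (simp add: R_def)
  have "((\<lambda>t. - ln (R t - (u + t * p)) - F t) has_real_derivative Gamma_slope (p, r) (u, w)) (at 0)"
    using u by (auto intro!: derivative_eq_intros R F simp: Gamma_slope_def R0)
      (simp add: minus_divide_left)
  then show ?thesis by (simp add: Gamma_rtdet_def R_def F_def)
qed

text \<open>
  The coefficients of the second direction in the derivative of \<^const>\<open>Gamma_slope\<close>; the term
  with \<open>P(w\<^sup>-\<^sup>1) r\<close> comes from the derivative of the inverse.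
\<close>

definition Gamma_hessian :: "real \<times> 'a::euclidean_jordan_algebra \<Rightarrow> real \<times> 'a \<Rightarrow> real \<times> 'a" where
  "Gamma_hessian = (\<lambda>(u, w) (p, r).
     let d = real (jrank TYPE('a)); \<zeta> = rtdet w - u; \<eta> = rtdet w / (d * \<zeta>);
         slope = rtdet w * jinner (jinv w) r / d - p
     in (- slope / \<zeta>\<^sup>2,
         (\<eta> * slope / \<zeta> - \<eta> * jinner (jinv w) r / d) *\<^sub>R jinv w + (1 + \<eta>) *\<^sub>R quad_rep (jinv w) r))"

lemma Gamma_slope_has_derivative:
  fixes w r r' :: "'a::euclidean_jordan_algebra"
  assumes w: "jpositive w" and u: "u < rtdet w"
  shows "((\<lambda>t. Gamma_slope (p, r) ((u, w) + t *\<^sub>R (p', r'))) has_real_derivative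
      prod_jinner (Gamma_hessian (u, w) (p, r)) (p', r')) (at 0)"
proof -
  define d where "d = real (jrank TYPE('a))"
  define \<phi> where "\<phi> = rtdet w"
  define \<zeta> where "\<zeta> = \<phi> - u"
  define T where "T = jinner (jinv w) r"
  define T' where "T' = jinner (jinv w) r'"
  define N where "N = jinner (quad_rep (jinv w) r') r"
  have d: "d > 0" using jrank_pos[where 'a='a] by (simp add: d_def)
  have z: "\<zeta> > 0" using u by (simp add: \<zeta>_def \<phi>_def)
  have "((\<lambda>t. Gamma_slope (p, r) ((u, w) + t *\<^sub>R (p', r'))) has_real_derivative
      - (((\<phi> * T' / d) * T / d - \<phi> * N / d) * \<zeta> - (\<phi> * T / d - p) * (\<phi> * T' / d - p')) / \<zeta>\<^sup>2 + N) (at 0)"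
  proof -
    define R J where "R = (\<lambda>t. rtdet (w + t *\<^sub>R r'))" and "J = (\<lambda>t. jinner (jinv (w + t *\<^sub>R r')) r)"
    have R: "(R has_real_derivative \<phi> * T' / d) (at 0)" and J: "(J has_real_derivative - N) (at 0)"
      using rtdet_has_derivative[OF w, of r'] jinner_jinv_has_derivative[OF w, of r' r]
      by (simp_all add: R_def J_def \<phi>_def T'_def N_def d_def)
    have R0: "R 0 = \<phi>" and J0: "J 0 = T" by (simp_all add: R_def J_def \<phi>_def T_def)
    have "((\<lambda>t. - (R t * J t / d - p) / (R t - (u + t * p')) - J t) has_real_derivative
        - (((\<phi> * T' / d) * T / d - \<phi> * N / d) * \<zeta> - (\<phi> * T / d - p) * (\<phi> * T' / d - p')) / \<zeta>\<^sup>2 + N) (at 0)"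
      using z d
      by (auto intro!: derivative_eq_intros R J simp: R0 J0 \<zeta>_def[symmetric] power2_eq_square)
        (simp add: field_simps)
    then show ?thesis by (simp add: Gamma_slope_def R_def J_def d_def)
  qed
  moreover have "prod_jinner (Gamma_hessian (u, w) (p, r)) (p', r')
      = (p - \<phi> * T / d) / \<zeta>\<^sup>2 * p'
        + (\<phi> / (d * \<zeta>) * (\<phi> * T / d - p) / \<zeta> - \<phi> / (d * \<zeta>) * T / d) * T' + (1 + \<phi> / (d * \<zeta>)) * N"
    by (simp add: Gamma_hessian_def prod_jinner_def Let_def jinner_linear_simps
        jinner_quad_rep[of _ r] jinner_commute[of r] T_def T'_def N_def d_def \<phi>_def \<zeta>_def)
      (metis minus_diff_eq minus_divide_left mult_minus_left)
  moreover have "- (((\<phi> * T' / d) * T / d - \<phi> * N / d) * \<zeta> - (\<phi> * T / d - p) * (\<phi> * T' / d - p')) / \<zeta>\<^sup>2 + N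
      = (p - \<phi> * T / d) / \<zeta>\<^sup>2 * p'
        + (\<phi> / (d * \<zeta>) * (\<phi> * T / d - p) / \<zeta> - \<phi> / (d * \<zeta>) * T / d) * T' + (1 + \<phi> / (d * \<zeta>)) * N"
    using d z by (simp add: field_simps power2_eq_square)
  ultimately show ?thesis by simp
qed

lemma linear_Gamma_hessian: "linear (Gamma_hessian (u, w :: 'a::euclidean_jordan_algebra))"
proof (rule linearI)
  show "Gamma_hessian (u, w) (x + y) = Gamma_hessian (u, w) x + Gamma_hessian (u, w) y"
    for x y :: "real \<times> 'a"
    by (cases x; cases y)
      (simp add: Gamma_hessian_def Let_def jinner_linear_simps linear_add[OF linear_quad_rep]
        add_divide_distrib diff_divide_distrib algebra_simps)
  show "Gamma_hessian (u, w) (c *\<^sub>R x) = c *\<^sub>R Gamma_hessian (u, w) x" for c and x :: "real \<times> 'a"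
    by (cases x)
      (simp add: Gamma_hessian_def Let_def jinner_linear_simps linear_scale[OF linear_quad_rep]
        add_divide_distrib diff_divide_distrib algebra_simps)
qed

lemma Gamma_hessian_selfadjoint:
  fixes x y :: "real \<times> 'a::euclidean_jordan_algebra"
  shows "prod_jinner (Gamma_hessian (u, w) x) y = prod_jinner x (Gamma_hessian (u, w) y)"
proof (cases x; cases y)
  fix p r p' r' assume xy: "x = (p, r)" "y = (p', r')"
  show ?thesis
    unfolding xy
    by (simp add: Gamma_hessian_def prod_jinner_def Let_def jinner_linear_simps
        jinner_quad_rep[of _ r] jinner_commute[of r "jinv w"] add_divide_distrib diff_divide_distrib
        power2_eq_square algebra_simps)
qed

lemma has_second_dir_deriv_unique:
  assumes "has_second_dir_deriv f x p q D" "has_second_dir_deriv f x p q E"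
  shows "D = E"
proof -
  obtain g h where g: "\<forall>\<^sub>F y in nhds x. ((\<lambda>t. f (y + t *\<^sub>R p)) has_real_derivative g y) (at 0)"
      "((\<lambda>t. g (x + t *\<^sub>R q)) has_real_derivative D) (at 0)"
    and h: "\<forall>\<^sub>F y in nhds x. ((\<lambda>t. f (y + t *\<^sub>R p)) has_real_derivative h y) (at 0)"
      "((\<lambda>t. h (x + t *\<^sub>R q)) has_real_derivative E) (at 0)"
    using assms unfolding has_second_dir_deriv_def by blast
  have "\<forall>\<^sub>F y in nhds x. g y = h y" using g(1) h(1) by eventually_elim (rule DERIV_unique)
  then have "\<forall>\<^sub>F t in nhds 0. g (x + t *\<^sub>R q) = h (x + t *\<^sub>R q)"
    using line_tendsto by (rule eventually_compose_filterlim)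
  then have "((\<lambda>t. g (x + t *\<^sub>R q)) has_real_derivative E) (at 0)"
    using h(2) by (subst DERIV_cong_ev[OF refl _ refl])
  then show ?thesis using g(2) DERIV_unique by blast
qed

text \<open>
  Second directional derivatives determine all pairings of \<open>H p\<close>, and the trace form is definite.
\<close>

lemma is_hessian_unique:
  fixes f :: "real \<times> 'a::euclidean_jordan_algebra \<Rightarrow> real"
  assumes "is_hessian f x H" "is_hessian f x G"
  shows "H = G"
proof
  fix p
  define z where "z = H p - G p"
  have "prod_jinner (H p) z = prod_jinner (G p) z"
    using assms has_second_dir_deriv_unique unfolding is_hessian_def by blast
  then have "fst z * fst z + jinner (snd z) (snd z) = 0"
    by (simp add: z_def prod_jinner_def jinner_linear_simps algebra_simps)
  moreover have "0 \<le> jinner (snd z) (snd z)" by (rule jinner_self_nonneg)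
  ultimately have "fst z = 0" "jinner (snd z) (snd z) = 0"
    using zero_le_square[of "fst z"] by (simp_all add: add_nonneg_eq_0_iff)
  then have "z = 0" using jinner_self_eq_0 by (simp add: prod_eq_iff)
  then show "H p = G p" by (simp add: z_def)
qed

lemma is_hessian_Gamma:
  fixes w :: "'a::euclidean_jordan_algebra"
  assumes "(u, w) \<in> interior K_rtdet"
  shows "is_hessian Gamma_rtdet (u, w) (Gamma_hessian (u, w))"
  unfolding is_hessian_def
proof (intro conjI allI)
  fix x y :: "real \<times> 'a"
  have "\<forall>\<^sub>F v in nhds (u, w). v \<in> interior K_rtdet"
    using assms by (intro eventually_nhds_in_open) auto
  then have "\<forall>\<^sub>F v in nhds (u, w).
      ((\<lambda>t. Gamma_rtdet (v + t *\<^sub>R x)) has_real_derivative Gamma_slope x v) (at 0)"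
  proof eventually_elim
    case (elim v)
    then show ?case
      using interior_K_rtdet[of "fst v" "snd v"]
        Gamma_rtdet_has_derivative[of "snd v" "fst v" "fst x" "snd x"] by simp
  qed
  then show "has_second_dir_deriv Gamma_rtdet (u, w) x y (prod_jinner (Gamma_hessian (u, w) x) y)"
    unfolding has_second_dir_deriv_def
    using Gamma_slope_has_derivative[OF interior_K_rtdet[OF assms], of "fst x" "snd x" "fst y" "snd y"]
    by auto
qed (rule linear_Gamma_hessian Gamma_hessian_selfadjoint)+

section \<open>Inverting the Hessian\<close>

lemma quad_rep_jsqrt:
  fixes w r :: "'a::euclidean_jordan_algebra"
  assumes w: "jpositive w"
  shows "quad_rep (jsqrt w) (quad_rep (jsqrt w) r) = quad_rep w r"
    and "quad_rep (jsqrt w) jone = w"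
    and "jtr (quad_rep (jsqrt w) r) = jinner w r"
proof -
  show "quad_rep (jsqrt w) (quad_rep (jsqrt w) r) = quad_rep w r"
    unfolding quad_rep_square jsqrt_square[OF w] ..
  show e: "quad_rep (jsqrt w) jone = w"
    by (simp add: quad_rep_def jL_def jone_right jsqrt_square[OF w] scaleR_2)
  have "jtr (quad_rep (jsqrt w) r) = jinner jone (quad_rep (jsqrt w) r)"
    by (simp add: jinner_def jone_left)
  then show "jtr (quad_rep (jsqrt w) r) = jinner w r"
    by (simp add: jinner_quad_rep[symmetric] e)
qed

text \<open>
  In terms of \<open>w\<close> alone the candidate inverse is \<open>k w + P(w) r / \<theta>\<close>.  Since \<open>P(w\<^sup>-\<^sup>1)\<close> maps it to
  \<open>k w\<^sup>-\<^sup>1 + r / \<theta>\<close>, only multiples of \<open>w\<^sup>-\<^sup>1\<close> have to be compared.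
\<close>

lemma Gamma_hessian_inverse:
  fixes w r :: "'a::euclidean_jordan_algebra" and p u d \<phi> \<zeta> \<eta> \<theta> \<tau> :: real
  assumes w: "jpositive w" and u: "u < rtdet w"
    and d_def: "d = real (jrank TYPE('a))" and \<phi>_def: "\<phi> = rtdet w"
    and \<zeta>_def: "\<zeta> = \<phi> - u" and \<eta>_def: "\<eta> = \<phi> / (d * \<zeta>)" and \<theta>_def: "\<theta> = 1 + \<eta>"
    and \<tau>_def: "\<tau> = jinner w r"
  shows "Gamma_hessian (u, w)
      ((\<zeta>\<^sup>2 + \<phi>\<^sup>2 / d) * p + \<phi> / d * \<tau>,
       ((\<phi> * p + \<eta> / \<theta> * \<tau>) / d) *\<^sub>R w + (1 / \<theta>) *\<^sub>R quad_rep w r) = (p, r)"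
proof -
  define k where "k = (\<phi> * p + \<eta> / \<theta> * \<tau>) / d"
  define h where "h = k *\<^sub>R w + (1 / \<theta>) *\<^sub>R quad_rep w r"
  define P where "P = (\<zeta>\<^sup>2 + \<phi>\<^sup>2 / d) * p + \<phi> / d * \<tau>"
  have d: "d > 0" using jrank_pos[where 'a='a] by (simp add: d_def)
  have z: "\<zeta> > 0" using u by (simp add: \<zeta>_def \<phi>_def)
  have "\<phi> > 0" by (simp add: \<phi>_def rtdet_eq_exp[OF w])
  then have "\<eta> > 0" using d z by (simp add: \<eta>_def)
  then have th: "\<theta> > 0" by (simp add: \<theta>_def)
  have ez: "\<eta> * \<zeta> = \<phi> / d" using d z by (simp add: \<eta>_def)
  have T: "jinner (jinv w) h = \<phi> * p + \<tau>"
  proof -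
    have "jinner (jinv w) h = k * d + \<tau> / \<theta>"
      by (simp add: h_def jinner_linear_simps jinner_jinv_self[OF w] jinner_quad_rep[symmetric]
          quad_rep_self_jinv[OF w] d_def \<tau>_def)
    also have "\<dots> = \<phi> * p + \<tau> * ((\<eta> + 1) / \<theta>)"
      using d by (simp add: k_def add_divide_distrib algebra_simps)
    finally show ?thesis using th by (simp add: \<theta>_def add.commute)
  qed
  have slope: "\<phi> * (\<phi> * p + \<tau>) / d - P = - (\<zeta>\<^sup>2 * p)"
    using d by (simp add: P_def field_simps power2_eq_square)
  have Ph: "quad_rep (jinv w) h = k *\<^sub>R jinv w + (1 / \<theta>) *\<^sub>R r"
    by (simp add: h_def linear_add[OF linear_quad_rep] linear_scale[OF linear_quad_rep]
        quad_rep_jinv_self[OF w] quad_rep_jinv_quad_rep[OF w])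
  have "\<theta> * k = (\<phi> * p + \<eta> * (\<phi> * p + \<tau>)) / d"
  proof -
    have "\<theta> * (\<phi> * p + \<eta> / \<theta> * \<tau>) = \<theta> * (\<phi> * p) + \<eta> * \<tau>"
      using th by (simp add: distrib_left)
    then have "\<theta> * k = (\<theta> * (\<phi> * p) + \<eta> * \<tau>) / d" by (simp add: k_def)
    then show ?thesis by (simp add: \<theta>_def algebra_simps)
  qed
  moreover have "\<eta> * (- (\<zeta>\<^sup>2 * p)) / \<zeta> = - (\<phi> / d * p)"
    using z unfolding ez[symmetric] by (simp add: power2_eq_square)
  ultimately have "\<eta> * (- (\<zeta>\<^sup>2 * p)) / \<zeta> - \<eta> * (\<phi> * p + \<tau>) / d + \<theta> * k = 0"
    by (simp add: add_divide_distrib)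
  note cancel = this
  have "Gamma_hessian (u, w) (P, h)
      = (- (\<phi> * (\<phi> * p + \<tau>) / d - P) / \<zeta>\<^sup>2,
         (\<eta> * (\<phi> * (\<phi> * p + \<tau>) / d - P) / \<zeta> - \<eta> * (\<phi> * p + \<tau>) / d) *\<^sub>R jinv w
           + \<theta> *\<^sub>R (k *\<^sub>R jinv w + (1 / \<theta>) *\<^sub>R r))"
    unfolding Gamma_hessian_def Let_def prod.case T Ph d_def[symmetric] \<phi>_def[symmetric]
      \<zeta>_def[symmetric] \<eta>_def[symmetric] \<theta>_def[symmetric] ..
  also have "\<dots> = (p, (\<eta> * (- (\<zeta>\<^sup>2 * p)) / \<zeta> - \<eta> * (\<phi> * p + \<tau>) / d + \<theta> * k) *\<^sub>R jinv w + r)"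
    unfolding slope using z th by (simp add: scaleR_add_right scaleR_add_left)
  also have "\<dots> = (p, r)" unfolding cancel by simp
  finally show ?thesis by (simp only: P_def h_def k_def)
qed

text \<open>
  The candidate inverse is a right inverse of a linear operator on a finite-dimensional space, so
  the operator is bijective.  \<open>P(w\<^sup>1\<^sup>/\<^sup>2)\<close> disappears from the claim through
  \<open>P(w\<^sup>1\<^sup>/\<^sup>2)\<^sup>2 = P(w)\<close>, \<open>P(w\<^sup>1\<^sup>/\<^sup>2) e = w\<close> and \<open>tr (P(w\<^sup>1\<^sup>/\<^sup>2) r) = tr (w \<circ> r)\<close>.
\<close>

theorem lemma7p1:
  fixes u p :: real
    and w r r' :: "'a::euclidean_jordan_algebra"
    and d :: nat
    and \<phi> \<zeta> \<eta> \<theta> :: real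
  assumes "d = jrank TYPE('a)"
    and "(u, w) \<in> interior K_rtdet"
    and "\<phi> = jdet w powr (1 / real d)"
    and "\<zeta> = \<phi> - u"
    and "\<eta> = \<phi> / (real d * \<zeta>)"
    and "\<theta> = 1 + \<eta>"
    and "r' = quad_rep (jsqrt w) r"
  shows "is_hessian Gamma_rtdet (u, w) (hessian Gamma_rtdet (u, w)) \<and>
    bij (hessian Gamma_rtdet (u, w)) \<and>
    inv (hessian Gamma_rtdet (u, w)) (p, r) =
      ((\<zeta>^2 + \<phi>^2 / real d) * p + \<phi> / real d * jtr r',
       quad_rep (jsqrt w)
         (((\<phi> * p + \<eta> / \<theta> * jtr r') / real d) *\<^sub>R jone + (1 / \<theta>) *\<^sub>R r'))"
proof -
  let ?H = "Gamma_hessian (u, w)"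
  note w = interior_K_rtdet[OF assms(2)]
  have hess: "hessian Gamma_rtdet (u, w) = ?H"
    unfolding hessian_def
    using is_hessian_Gamma[OF assms(2)] is_hessian_unique by (intro the_equality) blast+
  have \<phi>: "\<phi> = rtdet w" by (simp add: assms(1,3) rtdet_def)
  have d: "real d = real (jrank TYPE('a))" by (simp add: assms(1))
  note sol = Gamma_hessian_inverse[OF w d \<phi> assms(4-6) refl]
  have surj: "surj ?H"
  proof (rule surjI)
    show "?H ((\<zeta>\<^sup>2 + \<phi>\<^sup>2 / real d) * fst x + \<phi> / real d * jinner w (snd x),
       ((\<phi> * fst x + \<eta> / \<theta> * jinner w (snd x)) / real d) *\<^sub>R w + (1 / \<theta>) *\<^sub>R quad_rep w (snd x)) = x" for x
      using sol[of "fst x" "snd x"] by simp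
  qed
  have inj: "inj ?H" by (rule linear_surj_imp_inj[OF linear_Gamma_hessian surj])
  have "inv ?H (p, r) = ((\<zeta>\<^sup>2 + \<phi>\<^sup>2 / real d) * p + \<phi> / real d * jinner w r,
       ((\<phi> * p + \<eta> / \<theta> * jinner w r) / real d) *\<^sub>R w + (1 / \<theta>) *\<^sub>R quad_rep w r)"
    by (rule inv_f_eq[OF inj sol])
  then show ?thesis
    unfolding hess
    using is_hessian_Gamma[OF assms(2)] inj surj
    by (simp add: bij_def assms(7) quad_rep_jsqrt[OF w(1)]
        linear_add[OF linear_quad_rep] linear_scale[OF linear_quad_rep])
qed

end
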